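(* Consider the system $$\frac{dx}{dt}=xy,\qquad \frac{dy}{dt}=-\frac{y^2}{4}+3x .$$ The phase space $\mathcal{X}$ of this system can be obtained by gluing three copies $U_j\times\mathbb{C}=\mathbb{C}^2\times\mathbb{C}\ni(x_j,y_j,t)$, $j=0,1,2$, via the birational transformations $$\begin{aligned} 0)\;& x_0=x,\quad y_0=y,\\ 1)\;& x_1=\Bigl(x-\frac{y^2}{4}\Bigr)y,\quad y_1=\frac1y,\\ 2)\;& x_2=xy^4,\quad y_2=\frac1y . \end{aligned}$$
   Context: Gluing: points of different charts with the same $t$ are identified through the given birational relations wherever these are biregular. Phase space: the resulting complex manifold $\mathcal{X}$, fibred over the $t$-line $B$ (here $B=\mathbb{C}$), is the phase space (space of initial conditions) of the system if (i) rewritten in the coordinates $(x_j,y_j)$ of every chart, the system has right-hand sides that are polynomials in $(x_j,y_j)$ with coefficients holomorphic in $t$; and (ii) every solution $(x(t),y(t))$ that is meromorphic near a point $t_0\in B$ extends holomorphically across $t_0$ as a map into $\mathcal{X}$ (so poles of solutions become ordinary points of $\mathcal{X}$). *)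

theory Defs
  imports
    "HOL-Complex_Analysis.Complex_Analysis"
    "HOL-Computational_Algebra.Polynomial"
begin

type_synonym plane = "complex \<times> complex"

section \<open>Rational maps of the plane\<close>

text \<open>
  A polynomial in \<open>x\<close>, \<open>y\<close> is a polynomial in \<open>y\<close> with coefficients in \<open>\<complex>[x]\<close>. A rational map is
  represented by a total function, of which only the values on a non-empty Zariski open set
  matter; the values produced by the convention \<open>1 / 0 = 0\<close> therefore play no role.
\<close>

definition eval2 :: "complex poly poly \<Rightarrow> plane \<Rightarrow> complex" where
  "eval2 p z = poly (poly p [:snd z:]) (fst z)"

definition generically :: "(plane \<Rightarrow> bool) \<Rightarrow> bool" where
  "generically P \<longleftrightarrow> (\<exists>r. r \<noteq> 0 \<and> (\<forall>z. eval2 r z \<noteq> 0 \<longrightarrow> P z))"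

definition rational_map :: "(plane \<Rightarrow> plane) \<Rightarrow> bool" where
  "rational_map T \<longleftrightarrow> (\<exists>p1 q1 p2 q2. q1 \<noteq> 0 \<and> q2 \<noteq> 0 \<and>
     generically (\<lambda>z. T z = (eval2 p1 z / eval2 q1 z, eval2 p2 z / eval2 q2 z)))"

definition birational :: "(plane \<Rightarrow> plane) \<Rightarrow> bool" where
  "birational T \<longleftrightarrow> rational_map T \<and>
     (\<exists>S. rational_map S \<and> generically (\<lambda>z. S (T z) = z) \<and> generically (\<lambda>z. T (S z) = z))"

text \<open>
  For birational \<open>S\<close>, \<open>T\<close>: the rational map \<open>T \<circ> S\<^sup>-\<^sup>1\<close> is regular at \<open>P\<close> with value \<open>Q\<close>, that is, its
  components are quotients of polynomials whose denominators do not vanish at \<open>P\<close>. The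
  identity of rational maps is tested after composing with \<open>S\<close>.
\<close>

definition transition_regular :: "(plane \<Rightarrow> plane) \<Rightarrow> (plane \<Rightarrow> plane) \<Rightarrow> plane \<Rightarrow> plane \<Rightarrow> bool" where
  "transition_regular S T P Q \<longleftrightarrow> (\<exists>p1 q1 p2 q2. eval2 q1 P \<noteq> 0 \<and> eval2 q2 P \<noteq> 0 \<and>
     generically (\<lambda>z. T z = (eval2 p1 (S z) / eval2 q1 (S z), eval2 p2 (S z) / eval2 q2 (S z))) \<and>
     Q = (eval2 p1 P / eval2 q1 P, eval2 p2 P / eval2 q2 P))"

section \<open>Gluing\<close>

text \<open>
  \<open>Ts ! j\<close> expresses the coordinates \<open>(x\<^sub>j, y\<^sub>j)\<close> through the original coordinates \<open>(x, y)\<close>.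
  The point with coordinates \<open>(x\<^sub>j, y\<^sub>j, t)\<close> in chart \<open>j\<close> is \<open>(j, (x\<^sub>j, y\<^sub>j), t)\<close>.
\<close>

definition glue :: "(plane \<Rightarrow> plane) list \<Rightarrow>
    ((nat \<times> plane \<times> complex) \<times> (nat \<times> plane \<times> complex)) set" where
  "glue Ts = {((j, P, t), (k, Q, s)). j < length Ts \<and> k < length Ts \<and> t = s \<and>
     transition_regular (Ts ! j) (Ts ! k) P Q \<and> transition_regular (Ts ! k) (Ts ! j) Q P}"

definition glued_space :: "(plane \<Rightarrow> plane) list \<Rightarrow> (nat \<times> plane \<times> complex) set set" where
  "glued_space Ts = ({..<length Ts} \<times> UNIV) // glue Ts"

definition chart :: "(plane \<Rightarrow> plane) list \<Rightarrow> nat \<Rightarrow> plane \<times> complex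
    \<Rightarrow> (nat \<times> plane \<times> complex) set" where
  "chart Ts j w = glue Ts `` {(j, w)}"

definition glued_topology :: "(plane \<Rightarrow> plane) list \<Rightarrow> (nat \<times> plane \<times> complex) set topology" where
  "glued_topology Ts =
     topology (\<lambda>U. U \<subseteq> glued_space Ts \<and> (\<forall>j<length Ts. open (chart Ts j -` U)))"

lemma openin_glued_topology:
  "openin (glued_topology Ts) U \<longleftrightarrow>
     U \<subseteq> glued_space Ts \<and> (\<forall>j<length Ts. open (chart Ts j -` U))"
proof -
  have "istopology (\<lambda>U. U \<subseteq> glued_space Ts \<and> (\<forall>j<length Ts. open (chart Ts j -` U)))"
    unfolding istopology_def by (auto simp: vimage_Union)
  then show ?thesis
    unfolding glued_topology_def by (simp add: topology_inverse')
qed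

text \<open>Holomorphy in several variables: complex linearity of the Frechet derivative.\<close>

definition cscale :: "complex \<Rightarrow> plane \<times> complex \<Rightarrow> plane \<times> complex" where
  "cscale c = (\<lambda>((a, b), s). ((c * a, c * b), c * s))"

definition holomorphic_map_on :: "(plane \<times> complex \<Rightarrow> plane \<times> complex) \<Rightarrow> (plane \<times> complex) set \<Rightarrow> bool"
  where "holomorphic_map_on f W \<longleftrightarrow> open W \<and>
     (\<forall>w\<in>W. \<exists>D. (f has_derivative D) (at w) \<and> (\<forall>c v. D (cscale c v) = cscale c (D v)))"

definition glues_to_complex_manifold :: "(plane \<Rightarrow> plane) list \<Rightarrow> bool" where
  "glues_to_complex_manifold Ts \<longleftrightarrow>
     equiv ({..<length Ts} \<times> UNIV) (glue Ts) \<and>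
     Hausdorff_space (glued_topology Ts) \<and>
     second_countable (glued_topology Ts) \<and>
     (\<forall>j<length Ts.
        openin (glued_topology Ts) (range (chart Ts j)) \<and>
        homeomorphic_map euclidean
          (subtopology (glued_topology Ts) (range (chart Ts j))) (chart Ts j)) \<and>
     (\<forall>j<length Ts. \<forall>k<length Ts.
        holomorphic_map_on (\<lambda>w. inv (chart Ts k) (chart Ts j w))
          (chart Ts j -` range (chart Ts k)))"

text \<open>In every chart the projection is \<open>(P, t) \<mapsto> t\<close>, hence a surjective holomorphic submersion.\<close>

definition fibred_over_time :: "(plane \<Rightarrow> plane) list \<Rightarrow> bool" where
  "fibred_over_time Ts \<longleftrightarrow> (\<exists>\<pi>. continuous_map (glued_topology Ts) euclidean \<pi> \<and>
     (\<forall>j<length Ts. \<forall>P t. \<pi> (chart Ts j (P, t)) = (t::complex)))"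

section \<open>Differential systems\<close>

text \<open>
  \<open>V t (x, y)\<close> is the right-hand side of the system \<open>(x', y') = V t (x, y)\<close>, with \<open>t\<close> ranging over
  the base \<open>\<complex>\<close>.
\<close>

definition polynomial_system :: "(complex \<Rightarrow> plane \<Rightarrow> plane) \<Rightarrow> bool" where
  "polynomial_system F \<longleftrightarrow> (\<exists>n (a :: nat \<Rightarrow> nat \<Rightarrow> complex \<Rightarrow> complex) b.
     (\<forall>i\<le>n. \<forall>k\<le>n. a i k holomorphic_on UNIV \<and> b i k holomorphic_on UNIV) \<and>
     (\<forall>t x y. F t (x, y) =
        ((\<Sum>i\<le>n. \<Sum>k\<le>n. a i k t * x ^ i * y ^ k), (\<Sum>i\<le>n. \<Sum>k\<le>n. b i k t * x ^ i * y ^ k))))"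

text \<open>
  The chain rule: along solutions of \<open>V\<close>, \<open>(T z)' = DT(z) (V t z)\<close>. Both sides are compared as
  rational functions of \<open>z\<close>.
\<close>

definition rewritten_system ::
    "(complex \<Rightarrow> plane \<Rightarrow> plane) \<Rightarrow> (plane \<Rightarrow> plane) \<Rightarrow> (complex \<Rightarrow> plane \<Rightarrow> plane) \<Rightarrow> bool" where
  "rewritten_system V T F \<longleftrightarrow>
     (\<forall>t. generically (\<lambda>z. \<exists>D. (T has_derivative D) (at z) \<and> D (V t z) = F t (T z)))"

text \<open>
  \<^const>\<open>meromorphic_on\<close> ignores the values at \<open>t\<^sub>0\<close> itself, so the equations are required on a
  punctured neighbourhood of \<open>t\<^sub>0\<close>.
\<close>

definition meromorphic_solution_near ::
    "(complex \<Rightarrow> plane \<Rightarrow> plane) \<Rightarrow> complex \<Rightarrow> (complex \<Rightarrow> complex) \<Rightarrow> (complex \<Rightarrow> complex) \<Rightarrow> bool" where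
  "meromorphic_solution_near V t\<^sub>0 x y \<longleftrightarrow> x meromorphic_on {t\<^sub>0} \<and> y meromorphic_on {t\<^sub>0} \<and>
     (\<forall>\<^sub>F t in at t\<^sub>0.
        (x has_field_derivative fst (V t (x t, y t))) (at t) \<and>
        (y has_field_derivative snd (V t (x t, y t))) (at t))"

definition holomorphic_curve_on ::
    "(plane \<Rightarrow> plane) list \<Rightarrow> (complex \<Rightarrow> (nat \<times> plane \<times> complex) set) \<Rightarrow> complex set \<Rightarrow> bool" where
  "holomorphic_curve_on Ts \<Phi> D \<longleftrightarrow> (\<forall>s\<in>D. \<exists>j<length Ts. \<exists>e>0. \<exists>u v w.
     ball s e \<subseteq> D \<and> u holomorphic_on ball s e \<and> v holomorphic_on ball s e \<and>
     w holomorphic_on ball s e \<and> (\<forall>t\<in>ball s e. \<Phi> t = chart Ts j ((u t, v t), w t)))"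

text \<open>The head of \<open>Ts\<close> is the identity, so chart \<open>0\<close> carries the original coordinates.\<close>

definition phase_space_by_gluing ::
    "(complex \<Rightarrow> plane \<Rightarrow> plane) \<Rightarrow> (plane \<Rightarrow> plane) list \<Rightarrow> bool" where
  "phase_space_by_gluing V Ts \<longleftrightarrow>
     Ts \<noteq> [] \<and> hd Ts = id \<and> (\<forall>T\<in>set Ts. birational T) \<and>
     glues_to_complex_manifold Ts \<and> fibred_over_time Ts \<and>
     (\<forall>T\<in>set Ts. \<exists>F. polynomial_system F \<and> rewritten_system V T F) \<and>
     (\<forall>t\<^sub>0 x y. meromorphic_solution_near V t\<^sub>0 x y \<longrightarrow>
        (\<exists>r>0. \<exists>\<Phi>. holomorphic_curve_on Ts \<Phi> (ball t\<^sub>0 r) \<and>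
           (\<forall>t\<in>ball t\<^sub>0 r - {t\<^sub>0}. \<Phi> t = chart Ts 0 ((x t, y t), t))))"

end

theory Submission
  imports Defs
begin

text \<open>
  All transition maps are regular isomorphisms of \<open>{y \<noteq> 0}\<close> and have a pole along \<open>y = 0\<close>, so
  two points of different charts are glued exactly if they correspond to each other off the axes
  \<open>y\<^sub>j = 0\<close>. Points on the axes of two different charts are separated by \<open>y\<^sub>0 y\<^sub>k = 1\<close> for
  \<open>k = 1, 2\<close> and by \<open>4 x\<^sub>2 y\<^sub>2\<^sup>6 = 4 x\<^sub>1 y\<^sub>1\<^sup>3 + 1\<close>.

  Let \<open>s = t - t\<^sub>0\<close>. If a meromorphic solution has \<open>x = s\<^sup>n g\<close> with \<open>g(t\<^sub>0) \<noteq> 0\<close>, then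
  \<open>y = x'/x = n/s + g'/g\<close>, and the second equation only allows \<open>n = 0\<close> (regular in chart 0),
  \<open>n = 4\<close> (chart 2) and \<open>n = -2\<close> (chart 1). If \<open>x = 0\<close>, then \<open>y\<close> is regular or
  \<open>1/y\<close> vanishes at \<open>t\<^sub>0\<close>, and chart 0 or 2 applies.
\<close>

section \<open>Polynomials and Laurent polynomials on the plane\<close>

text \<open>The outer variable is y and the coefficients are polynomials in x, so
  \<open>[:0, 1:]\<close> is the function y and \<open>[:[:0, 1:]:]\<close> is the function
  x.\<close>

lemma eval2_add [simp]: "eval2 (p + q) z = eval2 p z + eval2 q z"
  and eval2_mult [simp]: "eval2 (p * q) z = eval2 p z * eval2 q z"
  and eval2_one [simp]: "eval2 1 z = 1"
  and eval2_const [simp]: "eval2 [:[:c:]:] z = c"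
  and eval2_fst [simp]: "eval2 [:[:0, 1:]:] z = fst z"
  and eval2_snd [simp]: "eval2 [:0, 1:] z = snd z"
  by (simp_all add: eval2_def)

lemma eval2_power [simp]: "eval2 (p ^ n) z = eval2 p z ^ n"
  by (induction n) auto

section \<open>Identities that hold off the zero set of a polynomial\<close>

lemma continuous_on_eval2 [continuous_intros]:
  assumes "continuous_on A f"
  shows "continuous_on A (\<lambda>z. eval2 p (f z))"
proof -
  have univ: "continuous_on UNIV (eval2 p)"
  proof (induction p)
    case (pCons a p)
    have "eval2 (pCons a p) = (\<lambda>z. poly a (fst z) + snd z * eval2 p z)"
      by (simp add: eval2_def fun_eq_iff)
    with pCons show ?case
      by (auto intro!: continuous_intros)
  qed (simp add: eval2_def)
  show ?thesis
    using continuous_on_compose2[OF univ assms] by simp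
qed

text \<open>A polynomial vanishing on an open box is zero: for each fixed y it has infinitely many
  roots x, so \<open>poly r [:y:]\<close> is zero; then infinitely many constants
  \<open>[:y:]\<close> are roots of \<open>r\<close> over the polynomials in x.\<close>

lemma eval2_nonzero_in_open:
  assumes "r \<noteq> 0" and "open U" and "U \<noteq> {}"
  shows "\<exists>z\<in>U. eval2 r z \<noteq> 0"
proof (rule ccontr)
  assume *: "\<not> ?thesis"
  obtain a b where "(a, b) \<in> U"
    using assms(3) by auto
  then obtain A B where AB: "open A" "open B" "a \<in> A" "b \<in> B" "A \<times> B \<subseteq> U"
    using open_prod_elim[OF assms(2)] by (metis mem_Sigma_iff)
  have inf: "infinite C" if "open C" "c \<in> C" for C :: "complex set" and c
    using that finite_imp_not_open by blast
  have "poly r [:y:] = 0" if "y \<in> B" for y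
  proof -
    have "A \<subseteq> {x. poly (poly r [:y:]) x = 0}"
      using * AB(5) that by (force simp: eval2_def)
    then show ?thesis
      using inf[OF AB(1,3)] poly_roots_finite finite_subset by blast
  qed
  then have "(\<lambda>y. [:y:]) ` B \<subseteq> {q. poly r q = 0}"
    by auto
  moreover have "infinite ((\<lambda>y. [:y:]) ` B)"
    using inf[OF AB(2,4)] by (simp add: finite_image_iff inj_on_def)
  ultimately show False
    using poly_roots_finite[OF assms(1)] finite_subset by blast
qed

text \<open>The points of \<open>U\<close> where \<open>f\<close> and \<open>g\<close> differ form
  an open set; if non-empty, it contains a point where \<open>r\<close> does not vanish. This turns
  generic identities into identities at every point.\<close>

lemma eq_on_open_if_generically_eq:
  fixes f g :: "plane \<Rightarrow> complex"
  assumes "r \<noteq> 0" and "open U" and "continuous_on U f" and "continuous_on U g"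
    and eq: "\<And>z. z \<in> U \<Longrightarrow> eval2 r z \<noteq> 0 \<Longrightarrow> f z = g z" and "z \<in> U"
  shows "f z = g z"
proof (rule ccontr)
  let ?W = "U \<inter> (\<lambda>z. f z - g z) -` (- {0})"
  assume "f z \<noteq> g z"
  then have "?W \<noteq> {}"
    using \<open>z \<in> U\<close> by auto
  moreover have "open ?W"
    by (intro continuous_open_preimage continuous_intros assms)
  ultimately obtain w where "w \<in> ?W" "eval2 r w \<noteq> 0"
    using eval2_nonzero_in_open[OF assms(1)] by blast
  then show False
    using eq[of w] by auto
qed

abbreviation off_axis :: "plane set" where
  "off_axis \<equiv> {z. snd z \<noteq> 0}"

lemma open_off_axis: "open off_axis"
  by (intro open_Collect_neq continuous_intros)

lemma eq_if_eq_off_axis: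
  fixes f g :: "plane \<Rightarrow> complex"
  assumes "continuous_on UNIV f" and "continuous_on UNIV g"
    and "\<And>z. snd z \<noteq> 0 \<Longrightarrow> f z = g z"
  shows "f z = g z"
  by (rule eq_on_open_if_generically_eq[where r = "[:0, 1:]" and U = UNIV]) (use assms in auto)

lemma generically_off_axis:
  assumes "\<And>z. snd z \<noteq> 0 \<Longrightarrow> P z"
  shows "generically P"
  unfolding generically_def
  by (rule exI[of _ "[:0, 1:]"]) (use assms in auto)

text \<open>The ring \<open>\<complex>[x, y, 1/y]\<close>; values at \<open>y = 0\<close> are junk.\<close>

inductive laurent :: "(plane \<Rightarrow> complex) \<Rightarrow> bool" where
  laurent_const: "laurent (\<lambda>z. c)"
| laurent_fst: "laurent fst"
| laurent_snd: "laurent snd"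
| laurent_divide_snd: "laurent f \<Longrightarrow> laurent (\<lambda>z. f z / snd z)"
| laurent_add: "laurent f \<Longrightarrow> laurent g \<Longrightarrow> laurent (\<lambda>z. f z + g z)"
| laurent_mult: "laurent f \<Longrightarrow> laurent g \<Longrightarrow> laurent (\<lambda>z. f z * g z)"

lemma laurent_diff: "laurent f \<Longrightarrow> laurent g \<Longrightarrow> laurent (\<lambda>z. f z - g z)"
  using laurent_add[OF _ laurent_mult[OF laurent_const[of "-1"]]] by fastforce

lemma laurent_power: "laurent f \<Longrightarrow> laurent (\<lambda>z. f z ^ n)"
  by (induction n) (auto intro: laurent.intros)

lemma laurent_divide_const: "laurent f \<Longrightarrow> laurent (\<lambda>z. f z / c)"
  using laurent_mult[OF _ laurent_const[of "inverse c"]] by (simp add: divide_inverse)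

lemma laurent_divide_power: "laurent f \<Longrightarrow> laurent (\<lambda>z. f z / snd z ^ n)"
  by (induction n) (auto dest: laurent_divide_snd simp: mult.commute)

lemma laurent_divide_monomial: "laurent f \<Longrightarrow> laurent (\<lambda>z. f z / (c * snd z ^ n))"
  using laurent_divide_power[OF laurent_divide_const] by simp

lemmas laurent_rules = laurent.intros laurent_diff laurent_power laurent_divide_const
  laurent_divide_power laurent_divide_monomial

text \<open>Induction over the ring operations, with a power of y as common denominator. It can
  vanish only on the axis, so these functions are regular off it.\<close>

lemma laurent_rational:
  assumes "laurent f"
  obtains p n where "\<And>z. snd z \<noteq> 0 \<Longrightarrow> f z = eval2 p z / eval2 ([:0, 1:] ^ n) z"
proof -
  have "\<exists>p n. \<forall>z. snd z \<noteq> 0 \<longrightarrow> f z = eval2 p z / snd z ^ n"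
    using assms
  proof induction
    case (laurent_const c)
    show ?case by (rule exI[of _ "[:[:c:]:]"], rule exI[of _ 0]) simp
  next
    case laurent_fst
    show ?case by (rule exI[of _ "[:[:0, 1:]:]"], rule exI[of _ 0]) simp
  next
    case laurent_snd
    show ?case by (rule exI[of _ "[:0, 1:]"], rule exI[of _ 0]) simp
  next
    case (laurent_divide_snd f)
    then obtain p n where "\<And>z. snd z \<noteq> 0 \<Longrightarrow> f z = eval2 p z / snd z ^ n" by blast
    then show ?case by (intro exI[of _ p] exI[of _ "Suc n"]) (simp add: field_simps)
  next
    case (laurent_add f g)
    then obtain p m q n where "\<And>z. snd z \<noteq> 0 \<Longrightarrow> f z = eval2 p z / snd z ^ m"
      "\<And>z. snd z \<noteq> 0 \<Longrightarrow> g z = eval2 q z / snd z ^ n" by blast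
    then show ?case
      by (intro exI[of _ "p * [:0, 1:] ^ n + q * [:0, 1:] ^ m"] exI[of _ "m + n"])
        (simp add: field_simps power_add)
  next
    case (laurent_mult f g)
    then obtain p m q n where "\<And>z. snd z \<noteq> 0 \<Longrightarrow> f z = eval2 p z / snd z ^ m"
      "\<And>z. snd z \<noteq> 0 \<Longrightarrow> g z = eval2 q z / snd z ^ n" by blast
    then show ?case
      by (intro exI[of _ "p * q"] exI[of _ "m + n"]) (simp add: power_add)
  qed
  then show ?thesis
    using that by auto
qed

text \<open>\<open>has_derivative\<close> alone gives real linearity, so complex homogeneity is
  carried through the induction; holomorphy of the transition maps rests on it.\<close>

lemma laurent_has_derivative:
  assumes "laurent f" and "snd z \<noteq> 0"
  shows "\<exists>D. (f has_derivative D) (at z) \<and> (\<forall>c a b. D (c * a, c * b) = c * D (a, b))"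
  using assms(1)
proof induction
  case (laurent_const c)
  show ?case by (rule exI[of _ "\<lambda>v. 0"]) auto
next
  case laurent_fst
  show ?case by (rule exI[of _ fst]) (auto intro!: derivative_eq_intros)
next
  case laurent_snd
  show ?case by (rule exI[of _ snd]) (auto intro!: derivative_eq_intros)
next
  case (laurent_divide_snd f)
  then obtain D where "(f has_derivative D) (at z)" "\<forall>c a b. D (c * a, c * b) = c * D (a, b)"
    by blast
  then show ?case
    using assms(2)
    by (intro exI[of _ "\<lambda>v. (D v * snd z - f z * snd v) / (snd z * snd z)"])
      (auto intro!: derivative_eq_intros simp: algebra_simps)
next
  case (laurent_add f g)
  then obtain D E where "(f has_derivative D) (at z)" "(g has_derivative E) (at z)"
    "\<forall>c a b. D (c * a, c * b) = c * D (a, b)" "\<forall>c a b. E (c * a, c * b) = c * E (a, b)" by blast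
  then show ?case
    by (intro exI[of _ "\<lambda>v. D v + E v"]) (auto intro!: derivative_eq_intros simp: algebra_simps)
next
  case (laurent_mult f g)
  then obtain D E where "(f has_derivative D) (at z)" "(g has_derivative E) (at z)"
    "\<forall>c a b. D (c * a, c * b) = c * D (a, b)" "\<forall>c a b. E (c * a, c * b) = c * E (a, b)" by blast
  then show ?case
    by (intro exI[of _ "\<lambda>v. f z * E v + D v * g z"])
      (auto intro!: derivative_eq_intros simp: algebra_simps)
qed

lemma laurent_continuous_on: "laurent f \<Longrightarrow> continuous_on off_axis f"
  by (rule continuous_at_imp_continuous_on)
    (use laurent_has_derivative has_derivative_continuous in blast)

definition laurent_map :: "(plane \<Rightarrow> plane) \<Rightarrow> bool" where
  "laurent_map T \<longleftrightarrow> laurent (\<lambda>z. fst (T z)) \<and> laurent (\<lambda>z. snd (T z))"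

lemma laurent_map_continuous_on: "laurent_map T \<Longrightarrow> continuous_on off_axis T"
  using continuous_on_Pair[of off_axis "\<lambda>z. fst (T z)" "\<lambda>z. snd (T z)"]
  by (simp add: laurent_map_def laurent_continuous_on)

lemma laurent_map_rational:
  assumes "laurent_map T"
  obtains p1 m p2 n where "\<And>z. snd z \<noteq> 0 \<Longrightarrow>
    T z = (eval2 p1 z / eval2 ([:0, 1:] ^ m) z, eval2 p2 z / eval2 ([:0, 1:] ^ n) z)"
proof -
  obtain p1 m p2 n where "\<And>z. snd z \<noteq> 0 \<Longrightarrow> fst (T z) = eval2 p1 z / eval2 ([:0, 1:] ^ m) z"
    "\<And>z. snd z \<noteq> 0 \<Longrightarrow> snd (T z) = eval2 p2 z / eval2 ([:0, 1:] ^ n) z"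
    using assms laurent_rational unfolding laurent_map_def by metis
  then show ?thesis
    using that by (metis prod.collapse)
qed

lemma laurent_map_rational_map: "laurent_map T \<Longrightarrow> rational_map T"
proof (erule laurent_map_rational)
  fix p1 m p2 n
  assume "\<And>z. snd z \<noteq> 0 \<Longrightarrow>
    T z = (eval2 p1 z / eval2 ([:0, 1:] ^ m) z, eval2 p2 z / eval2 ([:0, 1:] ^ n) z)"
  then show "rational_map T"
    unfolding rational_map_def
    by (intro exI[of _ p1] exI[of _ p2] exI[of _ "[:0, 1:] ^ m"] exI[of _ "[:0, 1:] ^ n"]
        conjI generically_off_axis) auto
qed

section \<open>The three charts and their transition maps\<close>

definition coords :: "(plane \<Rightarrow> plane) list" where
  "coords = [\<lambda>(x, y). (x, y),
     \<lambda>(x, y). ((x - y\<^sup>2 / 4) * y, 1 / y),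
     \<lambda>(x, y). (x * y ^ 4, 1 / y)]"

text \<open>Solving \<open>x\<^sub>1 = (x - y\<^sup>2 / 4) * y\<close> with
  \<open>y = 1 / y\<^sub>1\<close> gives the second entry; the third chart map is an involution off
  the axis.\<close>

definition coords_inv :: "(plane \<Rightarrow> plane) list" where
  "coords_inv = [\<lambda>(x, y). (x, y),
     \<lambda>(x, y). (x * y + 1 / (4 * y\<^sup>2), 1 / y),
     \<lambda>(x, y). (x * y ^ 4, 1 / y)]"

lemma length_coords [simp]: "length coords = 3"
  by (simp add: coords_def)

lemma all_less_3: "(\<forall>j<3. P j) \<longleftrightarrow> P 0 \<and> P 1 \<and> P (2::nat)"
  by (auto simp: numeral_eq_Suc less_Suc_eq)

lemma less_3_cases:
  assumes "(j::nat) < 3" obtains "j = 0" | "j = 1" | "j = 2"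
  using assms by linarith


text \<open>The second coordinate is y or 1/y throughout, so compositions of chart maps and their
  inverses never leave the region where all divisions are genuine.\<close>

lemma
  assumes "j < 3" and "snd z \<noteq> 0"
  shows snd_coords: "snd ((coords ! j) z) \<noteq> 0"
    and snd_coords_inv: "snd ((coords_inv ! j) z) \<noteq> 0"
  using assms by (auto simp: coords_def coords_inv_def case_prod_beta elim!: less_3_cases)

lemma coords_inv_coords:
  assumes "j < 3" and "snd z \<noteq> 0"
  shows "(coords_inv ! j) ((coords ! j) z) = z"
  using assms
  by (cases z) (auto simp: coords_def coords_inv_def divide_simps elim!: less_3_cases)

lemma coords_coords_inv:
  assumes "j < 3" and "snd z \<noteq> 0"
  shows "(coords ! j) ((coords_inv ! j) z) = z"
  using assms
  by (cases z) (auto simp: coords_def coords_inv_def divide_simps power2_eq_square elim!: less_3_cases)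

lemmas coords_laws = snd_coords snd_coords_inv coords_inv_coords coords_coords_inv

lemma laurent_map_coords: "j < 3 \<Longrightarrow> laurent_map (coords ! j)"
  by (auto simp: coords_def laurent_map_def case_prod_beta intro!: laurent_rules elim!: less_3_cases)

lemma laurent_map_coords_inv: "j < 3 \<Longrightarrow> laurent_map (coords_inv ! j)"
  by (auto simp: coords_inv_def laurent_map_def case_prod_beta
      intro!: laurent_rules elim!: less_3_cases)

lemma birational_coords: "j < 3 \<Longrightarrow> birational (coords ! j)"
  unfolding birational_def
  by (intro conjI exI[of _ "coords_inv ! j"] generically_off_axis laurent_map_rational_map
      laurent_map_coords laurent_map_coords_inv coords_inv_coords coords_coords_inv)

text \<open>The diagonal case is set apart because for \<open>j = 1, 2\<close> the composite of a
  chart map with its inverse would send every axis point to the origin, by 1/0 = 0.\<close>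

definition transition :: "nat \<Rightarrow> nat \<Rightarrow> plane \<Rightarrow> plane" where
  "transition j k = (if j = k then id else coords ! k \<circ> coords_inv ! j)"

lemma transition_eq:
  "\<lbrakk>j < 3; k < 3; snd z \<noteq> 0\<rbrakk> \<Longrightarrow> transition j k z = (coords ! k) ((coords_inv ! j) z)"
  by (simp add: transition_def coords_coords_inv)

lemma transition_coords:
  "\<lbrakk>j < 3; k < 3; snd z \<noteq> 0\<rbrakk> \<Longrightarrow> transition j k ((coords ! j) z) = (coords ! k) z"
  by (simp add: transition_eq coords_laws)

lemma snd_transition: "\<lbrakk>j < 3; k < 3; snd z \<noteq> 0\<rbrakk> \<Longrightarrow> snd (transition j k z) \<noteq> 0"
  by (simp add: transition_eq coords_laws)

lemma transition_transition:
  "\<lbrakk>j < 3; k < 3; l < 3; snd z \<noteq> 0\<rbrakk> \<Longrightarrow> transition k l (transition j k z) = transition j l z"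
  by (simp add: transition_eq coords_laws)

lemma transition_same [simp]: "transition j j z = z"
  by (simp add: transition_def)

lemma transition_simps:
  "transition 0 (Suc 0) (x, y) = ((x - y\<^sup>2 / 4) * y, 1 / y)"
  "transition 0 2 (x, y) = (x * y ^ 4, 1 / y)"
  "transition (Suc 0) 0 (x, y) = (x * y + 1 / (4 * y\<^sup>2), 1 / y)"
  "transition (Suc 0) 2 (x, y) = ((x * y + 1 / (4 * y\<^sup>2)) * (1 / y) ^ 4, y)"
  "transition 2 0 (x, y) = (x * y ^ 4, 1 / y)"
  "transition 2 (Suc 0) (x, y) = ((x * y ^ 4 - (1 / y)\<^sup>2 / 4) * (1 / y), y)"
  by (simp_all add: transition_def coords_def coords_inv_def)

text \<open>Charts 1 and 2 both have second coordinate 1/y. The resulting relation between chart 0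
  and another chart serves twice: as a pole on the axis, and to find disjoint
  neighbourhoods.\<close>

lemma snd_transition_0:
  assumes "j < 3" "k < 3" "j \<noteq> k" "j = 0 \<or> k = 0"
  shows "snd (transition j k z) = 1 / snd z"
  using assms(1,2)
  by (elim less_3_cases; use assms(3,4) in
      \<open>simp add: transition_def coords_def coords_inv_def case_prod_beta\<close>)

lemma laurent_map_transition:
  assumes "j < 3" and "k < 3"
  shows "laurent_map (transition j k)"
  using assms
  by (auto simp: transition_def coords_def coords_inv_def case_prod_beta laurent_map_def
      intro!: laurent_rules elim!: less_3_cases)

section \<open>The gluing relation\<close>

text \<open>Within one chart the quotients x/1 and y/1 work at every point; between two charts the
  denominators are powers of y, which do not vanish at \<open>P\<close>.\<close>

lemma transition_regularI:
  assumes "j < 3" "k < 3" "j = k \<or> snd P \<noteq> 0"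
  shows "transition_regular (coords ! j) (coords ! k) P (transition j k P)"
proof (cases "j = k")
  case True
  show ?thesis
    unfolding transition_regular_def True
    by (rule exI[of _ "[:[:0, 1:]:]"], rule exI[of _ 1], rule exI[of _ "[:0, 1:]"], rule exI[of _ 1])
      (auto intro: generically_off_axis)
next
  case False
  obtain p1 m p2 n where *: "\<And>z. snd z \<noteq> 0 \<Longrightarrow> transition j k z =
      (eval2 p1 z / eval2 ([:0, 1:] ^ m) z, eval2 p2 z / eval2 ([:0, 1:] ^ n) z)"
    using laurent_map_rational[OF laurent_map_transition[OF assms(1,2)]] by blast
  have "generically (\<lambda>z. (coords ! k) z =
      (eval2 p1 ((coords ! j) z) / eval2 ([:0, 1:] ^ m) ((coords ! j) z),
       eval2 p2 ((coords ! j) z) / eval2 ([:0, 1:] ^ n) ((coords ! j) z)))"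
    using * assms by (intro generically_off_axis) (metis snd_coords transition_coords)
  then show ?thesis
    unfolding transition_regular_def using * assms(3) False
    by (intro exI[of _ p1] exI[of _ "[:0, 1:] ^ m"] exI[of _ p2] exI[of _ "[:0, 1:] ^ n"]) auto
qed

text \<open>
  The denominator of \<open>f = p / q\<close> is cleared in the form \<open>f * q\<^sup>2 = p * q\<close>, which remains true
  where \<open>q = 0\<close> and \<open>p / q = 0\<close> by convention.
\<close>

definition quotient_at :: "(plane \<Rightarrow> complex) \<Rightarrow> plane \<Rightarrow> complex \<Rightarrow> bool" where
  "quotient_at f P v \<longleftrightarrow> (\<exists>p q. eval2 q P \<noteq> 0 \<and> v = eval2 p P / eval2 q P \<and>
     (\<forall>z. snd z \<noteq> 0 \<longrightarrow> f z * (eval2 q z)\<^sup>2 = eval2 p z * eval2 q z))"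

lemma quotient_at_off_axis:
  assumes "quotient_at f P v" and "snd P \<noteq> 0"
  shows "v = f P"
  using assms unfolding quotient_at_def
  by (metis (no_types, lifting) mult.assoc mult_right_cancel nonzero_eq_divide_eq power2_eq_square)

text \<open>Both sides of the cleared identity are continuous, so it extends to the axis, where a
  square of \<open>q\<close> may again be cancelled at \<open>P\<close>.\<close>

lemma quotient_at_continuous:
  assumes "quotient_at f P v" and "continuous_on UNIV f"
  shows "v = f P"
proof -
  obtain p q where "eval2 q P \<noteq> 0" "v = eval2 p P / eval2 q P"
    and *: "\<And>z. snd z \<noteq> 0 \<Longrightarrow> f z * (eval2 q z)\<^sup>2 = eval2 p z * eval2 q z"
    using assms(1) unfolding quotient_at_def by blast
  moreover have "f P * (eval2 q P)\<^sup>2 = eval2 p P * eval2 q P"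
    by (rule eq_if_eq_off_axis) (use * in \<open>auto intro!: continuous_intros assms(2)\<close>)
  ultimately show ?thesis
    by (metis mult.assoc mult_right_cancel nonzero_eq_divide_eq power2_eq_square)
qed

text \<open>Here \<open>f = n / d\<close> has a pole at \<open>P\<close>. Multiplying the cleared
  identity by \<open>d\<close> and extending it to the axis makes the left side nonzero at
  \<open>P\<close> and the right side zero.\<close>

lemma not_quotient_at:
  assumes "continuous_on UNIV n" and "continuous_on UNIV d"
    and "\<And>z. snd z \<noteq> 0 \<Longrightarrow> f z * d z = n z"
    and "d P = 0" and "n P \<noteq> 0"
  shows "\<not> quotient_at f P v"
proof
  assume "quotient_at f P v"
  then obtain p q where q: "eval2 q P \<noteq> 0"
    and *: "\<And>z. snd z \<noteq> 0 \<Longrightarrow> f z * (eval2 q z)\<^sup>2 = eval2 p z * eval2 q z"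
    unfolding quotient_at_def by blast
  have "n P * (eval2 q P)\<^sup>2 = eval2 p P * eval2 q P * d P"
  proof (rule eq_if_eq_off_axis)
    fix z :: plane
    assume "snd z \<noteq> 0"
    then show "n z * (eval2 q z)\<^sup>2 = eval2 p z * eval2 q z * d z"
      using *[of z] assms(3)[of z] by (metis mult.assoc mult.commute)
  qed (auto intro!: continuous_intros assms)
  with q assms(4,5) show False
    by simp
qed

text \<open>The identity for \<open>g\<close> is generic in the original coordinates. After clearing
  denominators it holds wherever y is nonzero, by continuity, and the inverse chart map then carries
  it over to the coordinates of chart \<open>j\<close>.\<close>

lemma quotient_atI:
  assumes "j < 3" and "continuous_on off_axis g" and "r \<noteq> 0"
    and "\<And>z. eval2 r z \<noteq> 0 \<Longrightarrow> g z = eval2 p ((coords ! j) z) / eval2 q ((coords ! j) z)"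
    and "\<And>z. snd z \<noteq> 0 \<Longrightarrow> f z = g ((coords_inv ! j) z)"
    and "eval2 q P \<noteq> 0" "v = eval2 p P / eval2 q P"
  shows "quotient_at f P v"
proof -
  let ?T = "coords ! j"
  have T: "continuous_on off_axis ?T"
    using laurent_map_continuous_on laurent_map_coords assms(1) by auto
  have *: "g z * (eval2 q (?T z))\<^sup>2 = eval2 p (?T z) * eval2 q (?T z)" if "z \<in> off_axis" for z
    by (rule eq_on_open_if_generically_eq[OF assms(3) open_off_axis _ _ _ that])
      (use assms(4) in \<open>auto intro!: continuous_intros T assms(2) simp: power2_eq_square\<close>)
  have "f z * (eval2 q z)\<^sup>2 = eval2 p z * eval2 q z" if "snd z \<noteq> 0" for z
    using *[of "(coords_inv ! j) z"] assms(1,5) that by (simp add: coords_laws)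
  then show ?thesis
    unfolding quotient_at_def using assms(6,7) by blast
qed

lemma transition_regular_quotient_at:
  assumes "j < 3" "k < 3" and "transition_regular (coords ! j) (coords ! k) P Q"
  shows "quotient_at (\<lambda>z. fst (transition j k z)) P (fst Q)"
    and "quotient_at (\<lambda>z. snd (transition j k z)) P (snd Q)"
proof -
  obtain p1 q1 p2 q2 r where pq: "eval2 q1 P \<noteq> 0" "eval2 q2 P \<noteq> 0"
      "Q = (eval2 p1 P / eval2 q1 P, eval2 p2 P / eval2 q2 P)" and "r \<noteq> 0"
    and r: "\<And>z. eval2 r z \<noteq> 0 \<Longrightarrow> (coords ! k) z =
      (eval2 p1 ((coords ! j) z) / eval2 q1 ((coords ! j) z),
       eval2 p2 ((coords ! j) z) / eval2 q2 ((coords ! j) z))"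
    using assms(3) unfolding transition_regular_def generically_def by blast
  have R: "continuous_on off_axis (coords ! k)"
    using laurent_map_continuous_on laurent_map_coords assms(2) by auto
  show "quotient_at (\<lambda>z. fst (transition j k z)) P (fst Q)"
    by (rule quotient_atI[where g = "\<lambda>z. fst ((coords ! k) z)" and j = j and p = p1 and q = q1,
          OF assms(1) _ \<open>r \<noteq> 0\<close>])
      (use pq r assms R in \<open>simp_all add: transition_eq continuous_on_fst\<close>)
  show "quotient_at (\<lambda>z. snd (transition j k z)) P (snd Q)"
    by (rule quotient_atI[where g = "\<lambda>z. snd ((coords ! k) z)" and j = j and p = p2 and q = q2,
          OF assms(1) _ \<open>r \<noteq> 0\<close>])
      (use pq r assms R in \<open>simp_all add: transition_eq continuous_on_snd\<close>)
qed

text \<open>On the axis between different charts some component has a pole, which contradicts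
  regularity; elsewhere the cleared identities determine the value \<open>Q\<close>.\<close>

lemma transition_regularD:
  assumes "j < 3" "k < 3" and "transition_regular (coords ! j) (coords ! k) P Q"
  shows "(j = k \<or> snd P \<noteq> 0) \<and> Q = transition j k P"
proof -
  note quot = transition_regular_quotient_at[OF assms]
  have axis: "j = k \<or> snd P \<noteq> 0"
  proof (rule ccontr)
    assume "\<not> ?thesis"
    then have "j \<noteq> k" and P: "snd P = 0"
      by auto
    then consider "j = 0 \<or> k = 0" | "j = 1" "k = 2" | "j = 2" "k = 1"
      using assms(1,2) \<open>j \<noteq> k\<close> by (elim less_3_cases; simp)
    then show False
    proof cases
      case 1
      \<comment> \<open>The second component is 1/y and has a pole along the axis.\<close>
      have "snd (transition j k z) * snd z = 1" if "snd z \<noteq> 0" for z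
        using 1 \<open>j \<noteq> k\<close> assms(1,2) that by (simp add: snd_transition_0)
      then have "\<not> quotient_at (\<lambda>z. snd (transition j k z)) P (snd Q)"
        by (intro not_quotient_at[of "\<lambda>z. 1" snd]) (auto intro!: continuous_intros simp: P)
      with quot(2) show False by blast
    next
      case 2
      \<comment> \<open>Charts 1 and 2 share their second coordinate, so the pole must come from the
        first one. The numerator equals 1 on the axis.\<close>
      have "fst (transition j k z) * (4 * snd z ^ 6) = 4 * fst z * snd z ^ 3 + 1"
        if "snd z \<noteq> 0" for z
        using that unfolding 2 One_nat_def
        by (cases z) (simp only: transition_simps, simp add: field_simps eval_nat_numeral)
      then have "\<not> quotient_at (\<lambda>z. fst (transition j k z)) P (fst Q)"
        by (intro not_quotient_at[of "\<lambda>z. 4 * fst z * snd z ^ 3 + 1" "\<lambda>z. 4 * snd z ^ 6"])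
          (auto intro!: continuous_intros simp: P)
      with quot(1) show False by blast
    next
      case 3
      \<comment> \<open>The same relation solved for the first coordinate of chart 1; the numerator
        equals -1 on the axis.\<close>
      have "fst (transition j k z) * (4 * snd z ^ 3) = 4 * fst z * snd z ^ 6 - 1"
        if "snd z \<noteq> 0" for z
        using that unfolding 3 One_nat_def
        by (cases z) (simp only: transition_simps, simp add: field_simps eval_nat_numeral)
      then have "\<not> quotient_at (\<lambda>z. fst (transition j k z)) P (fst Q)"
        by (intro not_quotient_at[of "\<lambda>z. 4 * fst z * snd z ^ 6 - 1" "\<lambda>z. 4 * snd z ^ 3"])
          (auto intro!: continuous_intros simp: P)
      with quot(1) show False by blast
    qed
  qed
  moreover have "Q = transition j k P"
  proof (cases "j = k")
    case True
    then have "continuous_on UNIV (\<lambda>z. fst (transition j k z))"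
      "continuous_on UNIV (\<lambda>z. snd (transition j k z))"
      by (auto intro!: continuous_intros)
    then show ?thesis
      using quot[THEN quotient_at_continuous] by (simp add: prod_eq_iff)
  next
    case False
    with axis show ?thesis
      using quot[THEN quotient_at_off_axis] by (simp add: prod_eq_iff)
  qed
  ultimately show ?thesis ..
qed

text \<open>From right to left, \<open>transition k j\<close> undoes \<open>transition j k\<close>
  and \<open>Q\<close> is again off the axis, so the reverse transition is regular at
  \<open>Q\<close> with value \<open>P\<close>.\<close>

lemma glue_coords_iff:
  "((j, P, t), (k, Q, s)) \<in> glue coords \<longleftrightarrow>
     j < 3 \<and> k < 3 \<and> t = s \<and> (j = k \<or> snd P \<noteq> 0) \<and> Q = transition j k P"
  (is "?L \<longleftrightarrow> ?R")
proof
  assume ?L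
  then show ?R
    unfolding glue_def using transition_regularD[of j k P Q] by simp
next
  assume R: ?R
  then have "transition_regular (coords ! j) (coords ! k) P Q"
    using transition_regularI by blast
  moreover have "transition k j Q = P" "k = j \<or> snd Q \<noteq> 0"
    using R transition_transition[of j k j P] snd_transition[of j k P] by auto
  then have "transition_regular (coords ! k) (coords ! j) Q P"
    using R transition_regularI by metis
  ultimately show ?L
    using R by (simp add: glue_def)
qed

lemma equiv_glue: "equiv ({..<3} \<times> UNIV) (glue coords)"
proof (rule equivI)
  show "glue coords \<subseteq> ({..<3} \<times> UNIV) \<times> ({..<3} \<times> UNIV)"
    by (auto simp: glue_coords_iff)
  show "refl_on ({..<3} \<times> UNIV) (glue coords)"
    by (auto simp: refl_on_def glue_coords_iff)
  show "sym (glue coords)"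
    by (rule symI) (auto simp: glue_coords_iff transition_transition snd_transition)
  show "trans (glue coords)"
    by (rule transI) (auto simp: glue_coords_iff transition_transition snd_transition)
qed

lemma chart_eq_iff:
  assumes "j < 3" "k < 3"
  shows "chart coords j w = chart coords k w' \<longleftrightarrow>
    snd w = snd w' \<and> (j = k \<or> snd (fst w) \<noteq> 0) \<and> fst w' = transition j k (fst w)"
  unfolding chart_def
  using eq_equiv_class_iff[OF equiv_glue, of "(j, w)" "(k, w')"] assms
  by (cases w; cases w') (auto simp: glue_coords_iff)

lemma inj_chart: "j < 3 \<Longrightarrow> inj (chart coords j)"
  by (rule injI) (auto simp: chart_eq_iff prod_eq_iff)

lemma glued_space_coords: "glued_space coords = (\<Union>j<3. range (chart coords j))"
  by (auto simp: glued_space_def chart_def quotient_def)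

lemma glued_space_cases:
  assumes "p \<in> glued_space coords"
  obtains j w where "j < 3" "p = chart coords j w"
  using assms by (auto simp: glued_space_coords)

lemma chart_in_glued_space: "j < 3 \<Longrightarrow> chart coords j w \<in> glued_space coords"
  by (auto simp: glued_space_coords)

section \<open>The glued manifold\<close>

definition transition_map :: "nat \<Rightarrow> nat \<Rightarrow> plane \<times> complex \<Rightarrow> plane \<times> complex" where
  "transition_map j k w = (transition j k (fst w), snd w)"

abbreviation overlap :: "nat \<Rightarrow> nat \<Rightarrow> (plane \<times> complex) set" where
  "overlap j k \<equiv> {w. j = k \<or> snd (fst w) \<noteq> 0}"

lemma open_overlap: "open (overlap j k)"
  by (cases "j = k") (auto intro!: open_Collect_neq continuous_intros)

lemma continuous_on_transition_map:
  assumes "j < 3" "k < 3"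
  shows "continuous_on (overlap j k) (transition_map j k)"
proof (cases "j = k")
  case True
  then show ?thesis
    by (simp add: transition_map_def continuous_on_id)
next
  case False
  have "continuous_on (overlap j k) (\<lambda>w. transition j k (fst w))"
    by (rule continuous_on_compose2[OF laurent_map_continuous_on[OF laurent_map_transition[OF assms]]])
      (use False in \<open>auto intro!: continuous_intros\<close>)
  then show ?thesis
    unfolding transition_map_def by (intro continuous_intros)
qed

text \<open>Reduces openness in the glued space to openness in coordinate space, where the
  transition maps are continuous on the overlaps.\<close>

lemma vimage_chart_image:
  assumes "j < 3" "k < 3"
  shows "chart coords j -` chart coords k ` W = overlap j k \<inter> transition_map j k -` W"
  using assms by (force simp: chart_eq_iff transition_map_def image_iff)

lemma openin_chart_image:
  assumes "j < 3" "open W"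
  shows "openin (glued_topology coords) (chart coords j ` W)"
  unfolding openin_glued_topology
proof (intro conjI allI impI)
  show "chart coords j ` W \<subseteq> glued_space coords"
    using assms(1) by (auto simp: chart_in_glued_space)
  fix k assume "k < length coords"
  then show "open (chart coords k -` chart coords j ` W)"
    using assms
    by (simp add: vimage_chart_image continuous_open_preimage continuous_on_transition_map open_overlap)
qed

lemma topspace_glued_topology: "topspace (glued_topology coords) = glued_space coords"
proof (rule antisym)
  show "topspace (glued_topology coords) \<subseteq> glued_space coords"
    using openin_glued_topology openin_topspace by blast
  show "glued_space coords \<subseteq> topspace (glued_topology coords)"
    using openin_chart_image[OF _ open_UNIV] openin_subset
    by (fastforce simp: glued_space_coords)
qed

lemma homeomorphic_map_chart:
  assumes "j < 3"
  shows "homeomorphic_map euclidean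
    (subtopology (glued_topology coords) (range (chart coords j))) (chart coords j)"
proof (rule bijective_open_imp_homeomorphic_map)
  show "continuous_map euclidean
      (subtopology (glued_topology coords) (range (chart coords j))) (chart coords j)"
    unfolding continuous_map_in_subtopology
    using assms
    by (auto simp: continuous_map_def topspace_glued_topology
        chart_in_glued_space openin_glued_topology vimage_def)
  show "open_map euclidean
      (subtopology (glued_topology coords) (range (chart coords j))) (chart coords j)"
    unfolding open_map_def openin_subtopology
    using openin_chart_image[OF assms] by fastforce
  show "chart coords j ` topspace euclidean =
      topspace (subtopology (glued_topology coords) (range (chart coords j)))"
    using assms by (auto simp: topspace_glued_topology chart_in_glued_space)
  show "inj_on (chart coords j) (topspace euclidean)"
    using inj_chart[OF assms] by simp
qed

text \<open>The images of one countable basis of the coordinate space under the three open charts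
  form a basis.\<close>

lemma second_countable_glued_topology: "second_countable (glued_topology coords)"
proof -
  obtain B :: "(plane \<times> complex) set set" where B: "countable B" "topological_basis B"
    using ex_countable_basis by blast
  let ?B = "\<Union>j<3. (`) (chart coords j) ` B"
  show ?thesis
    unfolding second_countable_def
  proof (intro exI[of _ ?B] conjI ballI allI impI)
    show "countable ?B"
      using B(1) by auto
    show "openin (glued_topology coords) V" if "V \<in> ?B" for V
      using that topological_basis_open[OF B(2)] by (auto intro!: openin_chart_image)
    fix U x
    assume U: "openin (glued_topology coords) U \<and> x \<in> U"
    then have "x \<in> glued_space coords"
      using openin_glued_topology by blast
    then obtain j w where j: "j < 3" "x = chart coords j w"
      by (rule glued_space_cases)
    then have "open (chart coords j -` U)" "w \<in> chart coords j -` U"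
      using U by (auto simp: openin_glued_topology)
    then obtain W where "W \<in> B" "w \<in> W" "W \<subseteq> chart coords j -` U"
      using topological_basisE[OF B(2)] by blast
    then show "\<exists>V\<in>?B. x \<in> V \<and> V \<subseteq> U"
      using j by (intro bexI[of _ "chart coords j ` W"]) auto
  qed
qed

section \<open>Separation of points by chart neighbourhoods\<close>

lemma disjoint_chart_images:
  assumes "j < 3" "k < 3" "j \<noteq> k"
    and "\<And>P t. \<lbrakk>snd P \<noteq> 0; (P, t) \<in> U; (transition j k P, t) \<in> V\<rbrakk> \<Longrightarrow> False"
  shows "disjnt (chart coords j ` U) (chart coords k ` V)"
  using assms by (force simp: disjnt_iff chart_eq_iff)

text \<open>Stated for representatives instead of classes, so that a point can be moved to another
  chart before it is separated.\<close>

definition separated :: "nat \<times> plane \<times> complex \<Rightarrow> nat \<times> plane \<times> complex \<Rightarrow> bool" where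
  "separated a b \<longleftrightarrow> (\<exists>U V. open U \<and> open V \<and> snd a \<in> U \<and> snd b \<in> V \<and>
     disjnt (chart coords (fst a) ` U) (chart coords (fst b) ` V))"

lemma separated_sym: "separated a b \<Longrightarrow> separated b a"
  unfolding separated_def by (meson disjnt_sym)

lemma separated_same_chart:
  assumes "j < 3" "w \<noteq> w'"
  shows "separated (j, w) (j, w')"
proof -
  obtain U V where "open U" "open V" "w \<in> U" "w' \<in> V" "U \<inter> V = {}"
    using hausdorff[OF assms(2)] by blast
  then show ?thesis
    unfolding separated_def disjnt_def using image_Int[OF inj_chart[OF assms(1)], of U V]
    by (intro exI[of _ U] exI[of _ V]) auto
qed

lemma separated_axis_less:
  assumes "j < k" "k < 3" "snd P = 0" "snd Q = 0"
  shows "separated (j, P, t) (k, Q, s)"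
proof (cases "j = 0")
  case True
  \<comment> \<open>On both neighbourhoods the second coordinate has modulus below 1, while glued
    points have second coordinates with product 1. Time is not restricted, so the times of the two
    points may differ.\<close>
  let ?U = "{w :: plane \<times> complex. norm (snd (fst w)) < 1}"
  have "open ?U"
    by (intro open_Collect_less continuous_intros)
  moreover have "disjnt (chart coords j ` ?U) (chart coords k ` ?U)"
  proof (rule disjoint_chart_images)
    fix P t
    assume P: "snd P \<noteq> 0" "(P, t) \<in> ?U" "(transition j k P, t) \<in> ?U"
    have "snd (transition j k P) = 1 / snd P"
      using True assms(1,2) by (simp add: snd_transition_0)
    with P have "norm (1 / snd P) < 1" "norm (snd P) < 1"
      by auto
    with P(1) show False
      by (simp add: norm_divide divide_simps)
  qed (use assms in auto)
  ultimately show ?thesis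
    unfolding separated_def using assms by (intro exI[of _ ?U]) auto
next
  case False
  then have jk: "j = 1" "k = 2"
    using assms(1,2) by auto
  \<comment> \<open>Glued points satisfy \<open>4 * x\<^sub>2 * y\<^sub>2 ^ 6 - 4 * x\<^sub>1 *
    y\<^sub>1 ^ 3 = 1\<close>. Both terms vanish on the axes, and bounding each by 1/2 makes the
    difference less than 1.\<close>
  let ?U = "{w :: plane \<times> complex. norm (4 * fst (fst w) * snd (fst w) ^ 3) < 1 / 2}"
  let ?V = "{w :: plane \<times> complex. norm (4 * fst (fst w) * snd (fst w) ^ 6) < 1 / 2}"
  have "open ?U" "open ?V"
    by (intro open_Collect_less continuous_intros)+
  moreover have "disjnt (chart coords j ` ?U) (chart coords k ` ?V)"
  proof (rule disjoint_chart_images)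
    fix P t
    assume P: "snd P \<noteq> 0" "(P, t) \<in> ?U" "(transition j k P, t) \<in> ?V"
    obtain x y where xy: "P = (x, y)"
      by (cases P)
    let ?x' = "fst (transition j k P)"
    have "4 * ?x' * y ^ 6 = 4 * x * y ^ 3 + 1"
      using P(1) unfolding jk xy One_nat_def transition_simps
      by (simp add: field_simps eval_nat_numeral)
    moreover have "norm (4 * x * y ^ 3) < 1 / 2" "norm (4 * ?x' * y ^ 6) < 1 / 2"
      using P(2,3) unfolding jk xy by (simp_all add: transition_simps)
    ultimately show False
      using norm_triangle_ineq4[of "4 * ?x' * y ^ 6" "4 * x * y ^ 3"] by simp
  qed (use jk in auto)
  ultimately show ?thesis
    unfolding separated_def using assms by (intro exI[of _ ?U] exI[of _ ?V]) auto
qed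

text \<open>A neighbourhood of the point in chart \<open>k\<close> is pulled back along the
  transition map, which is continuous on the open overlap.\<close>

lemma separated_cong:
  assumes "j < 3" "k < 3" "snd P \<noteq> 0" "separated (k, transition j k P, t) b"
  shows "separated (j, P, t) b"
proof -
  obtain U V where UV: "open U" "open V" "(transition j k P, t) \<in> U" "snd b \<in> V"
    "disjnt (chart coords k ` U) (chart coords (fst b) ` V)"
    using assms(4) by (auto simp: separated_def)
  let ?U = "overlap j k \<inter> transition_map j k -` U"
  have "open ?U"
    by (rule continuous_open_preimage[OF continuous_on_transition_map open_overlap UV(1)])
      (use assms in auto)
  moreover have "chart coords j ` ?U \<subseteq> chart coords k ` U"
    unfolding vimage_chart_image[OF assms(1,2), symmetric] by auto
  then have "disjnt (chart coords j ` ?U) (chart coords (fst b) ` V)"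
    using UV(5) disjnt_subset1 by blast
  ultimately show ?thesis
    unfolding separated_def using UV assms(3)
    by (intro exI[of _ ?U] exI[of _ V]) (auto simp: transition_map_def)
qed

text \<open>If one point is off its axis, it is moved to the chart of the other, and the coordinate
  space is Hausdorff. Two axis points of different charts are covered by the explicit
  neighbourhoods.\<close>

lemma separatedI:
  assumes jk: "j < 3" "k < 3" and neq: "chart coords j (P, t) \<noteq> chart coords k (Q, s)"
  shows "separated (j, P, t) (k, Q, s)"
proof -
  have off: "separated (j, P, t) (k, Q, s)"
    if "j < 3" "k < 3" "snd P \<noteq> 0" "chart coords j (P, t) \<noteq> chart coords k (Q, s)" for j k P Q t s
  proof (rule separated_cong[where k = k])
    show "separated (k, transition j k P, t) (k, Q, s)"
      using that by (intro separated_same_chart) (auto simp: chart_eq_iff)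
  qed (use that in auto)
  consider "snd P \<noteq> 0" | "snd Q \<noteq> 0" | "j = k" | "j < k" "snd P = 0" "snd Q = 0"
    | "k < j" "snd P = 0" "snd Q = 0"
    by linarith
  then show ?thesis
  proof cases
    case 2
    then show ?thesis
      using off[of k j Q s P t] assms by (auto intro: separated_sym)
  next
    case 3
    then show ?thesis
      using separated_same_chart[of j "(P, t)" "(Q, s)"] assms by auto
  next
    case 4
    then show ?thesis
      using separated_axis_less jk by blast
  next
    case 5
    then show ?thesis
      using separated_axis_less separated_sym jk by blast
  qed (use off assms in blast)
qed

lemma Hausdorff_glued_topology: "Hausdorff_space (glued_topology coords)"
  unfolding Hausdorff_space_def topspace_glued_topology
proof (intro allI impI)
  fix p q
  assume pq: "p \<in> glued_space coords \<and> q \<in> glued_space coords \<and> p \<noteq> q"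
  then obtain j P t k Q s where "j < 3" "k < 3" "p = chart coords j (P, t)" "q = chart coords k (Q, s)"
    by (metis glued_space_cases prod.collapse)
  moreover from this have "separated (j, P, t) (k, Q, s)"
    using separatedI pq by blast
  then obtain U V where "open U" "open V" "(P, t) \<in> U" "(Q, s) \<in> V"
    "disjnt (chart coords j ` U) (chart coords k ` V)"
    by (auto simp: separated_def)
  ultimately show "\<exists>U V. openin (glued_topology coords) U \<and> openin (glued_topology coords) V \<and>
      p \<in> U \<and> q \<in> V \<and> disjnt U V"
    by (intro exI[of _ "chart coords j ` U"] exI[of _ "chart coords k ` V"])
      (simp add: openin_chart_image)
qed

section \<open>Complex structure and projection to time\<close>

lemma holomorphic_transition_map:
  assumes "j < 3" "k < 3"
  shows "holomorphic_map_on (transition_map j k) (overlap j k)"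
  unfolding holomorphic_map_on_def
proof (intro conjI ballI open_overlap)
  fix w
  assume w: "w \<in> overlap j k"
  show "\<exists>D. (transition_map j k has_derivative D) (at w) \<and> (\<forall>c v. D (cscale c v) = cscale c (D v))"
  proof (cases "j = k")
    case True
    then have "transition_map j k = id"
      by (auto simp: transition_map_def)
    then show ?thesis
      by (auto intro!: exI[of _ id] simp: id_def)
  next
    case False
    with w have w: "snd (fst w) \<noteq> 0"
      by simp
    let ?f = "\<lambda>z. fst (transition j k z)" and ?g = "\<lambda>z. snd (transition j k z)"
    have "laurent ?f" "laurent ?g"
      using laurent_map_transition[OF assms] by (simp_all add: laurent_map_def)
    from this[THEN laurent_has_derivative, OF w]
    obtain D E where D: "(?f has_derivative D) (at (fst w))" "\<forall>c a b. D (c * a, c * b) = c * D (a, b)"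
      and E: "(?g has_derivative E) (at (fst w))" "\<forall>c a b. E (c * a, c * b) = c * E (a, b)"
      by (elim exE conjE)
    have fst': "(fst has_derivative fst) (at w)"
      by (auto intro!: derivative_eq_intros)
    have "((\<lambda>w. ((?f (fst w), ?g (fst w)), snd w)) has_derivative
        (\<lambda>v. ((D (fst v), E (fst v)), snd v))) (at w)"
      by (intro has_derivative_Pair has_derivative_compose[OF fst' D(1)]
          has_derivative_compose[OF fst' E(1)] has_derivative_snd[OF has_derivative_ident])
    moreover have "(\<lambda>w. ((?f (fst w), ?g (fst w)), snd w)) = transition_map j k"
      by (simp add: transition_map_def fun_eq_iff)
    ultimately show ?thesis
      using D(2) E(2)
      by (intro exI[of _ "\<lambda>v. ((D (fst v), E (fst v)), snd v)"])
        (auto simp: cscale_def case_prod_beta)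
  qed
qed

lemma holomorphic_map_on_cong:
  assumes "holomorphic_map_on f W" and "\<And>w. w \<in> W \<Longrightarrow> f w = g w"
  shows "holomorphic_map_on g W"
  using assms has_derivative_transform_within_open unfolding holomorphic_map_on_def by blast

lemma vimage_range_chart:
  "\<lbrakk>j < 3; k < 3\<rbrakk> \<Longrightarrow> chart coords j -` range (chart coords k) = overlap j k"
  using vimage_chart_image[of j k UNIV] by simp

lemma glues_to_complex_manifold_coords: "glues_to_complex_manifold coords"
  unfolding glues_to_complex_manifold_def length_coords
proof (intro conjI allI impI)
  fix j k :: nat
  assume jk: "j < 3" "k < 3"
  show "holomorphic_map_on (\<lambda>w. inv (chart coords k) (chart coords j w))
      (chart coords j -` range (chart coords k))"
    unfolding vimage_range_chart[OF jk]
  proof (rule holomorphic_map_on_cong[OF holomorphic_transition_map[OF jk]])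
    fix w
    assume "w \<in> overlap j k"
    then have "chart coords j w = chart coords k (transition_map j k w)"
      using jk by (auto simp: chart_eq_iff transition_map_def)
    then show "transition_map j k w = inv (chart coords k) (chart coords j w)"
      using inv_f_f[OF inj_chart[OF jk(2)]] by metis
  qed
qed (simp_all add: equiv_glue Hausdorff_glued_topology second_countable_glued_topology
    openin_chart_image homeomorphic_map_chart)

lemma fibred_over_time_coords: "fibred_over_time coords"
proof -
  \<comment> \<open>Gluing preserves t, so all representatives of a class carry the same t and the
    choice is unambiguous.\<close>
  define \<pi> :: "(nat \<times> plane \<times> complex) set \<Rightarrow> complex" where "\<pi> p = (SOME t. \<exists>j P. (j, P, t) \<in> p)" for p
  have \<pi>: "\<pi> (chart coords j (P, t)) = t" if "j < 3" for j P t
    unfolding \<pi>_def chart_def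
    by (rule some_equality) (use that in \<open>auto simp: glue_coords_iff\<close>)
  have "continuous_map (glued_topology coords) euclidean \<pi>"
    unfolding continuous_map_def
  proof (intro conjI allI impI)
    fix V :: "complex set"
    assume "openin euclidean V"
    then have V: "open V"
      by simp
    have "chart coords j -` {p \<in> glued_space coords. \<pi> p \<in> V} = snd -` V" if "j < 3" for j
      using that by (auto simp: \<pi> chart_in_glued_space)
    then show "openin (glued_topology coords) {p \<in> topspace (glued_topology coords). \<pi> p \<in> V}"
      unfolding openin_glued_topology topspace_glued_topology length_coords
      using open_vimage_snd[OF V] by auto
  qed auto
  with \<pi> show ?thesis
    unfolding fibred_over_time_def by (auto simp: length_coords)
qed

section \<open>The system in the three charts\<close>

lemma sum_monomial:
  fixes x y c :: complex
  assumes "p \<le> n" "q \<le> n"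
  shows "(\<Sum>i\<le>n. \<Sum>k\<le>n. (if i = p \<and> k = q then c else 0) * x ^ i * y ^ k) = c * x ^ p * y ^ q"
proof -
  have "(\<Sum>k\<le>n. (if i = p \<and> k = q then c else 0) * x ^ i * y ^ k) =
      (if i = p then c * x ^ p * y ^ q else 0)" for i
    using assms(2) by (simp add: if_distrib[of "\<lambda>u. u * _"] cong: if_cong)
  then show ?thesis
    using assms(1) by simp
qed

text \<open>In every chart the system has one monomial in the first component and two in the second,
  with constant coefficients; this shape covers all three.\<close>

lemma polynomial_systemI:
  fixes c1 c2 c3 :: complex
  assumes "\<And>t x y. F t (x, y) = (c1 * x ^ p1 * y ^ q1, c2 * x ^ p2 * y ^ q2 + c3 * x ^ p3 * y ^ q3)"
  shows "polynomial_system F"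
proof -
  define n where "n = Max {p1, q1, p2, q2, p3, q3}"
  have n: "p1 \<le> n" "q1 \<le> n" "p2 \<le> n" "q2 \<le> n" "p3 \<le> n" "q3 \<le> n"
    by (auto simp: n_def)
  show ?thesis
    unfolding polynomial_system_def
    by (rule exI[of _ n], rule exI[of _ "\<lambda>i k t. if i = p1 \<and> k = q1 then c1 else 0"],
        rule exI[of _ "\<lambda>i k t. (if i = p2 \<and> k = q2 then c2 else 0) + (if i = p3 \<and> k = q3 then c3 else 0)"])
      (simp add: assms sum.distrib distrib_right sum_monomial n)
qed

definition rhs :: "complex \<Rightarrow> plane \<Rightarrow> plane" where
  "rhs = (\<lambda>t (x, y). (x * y, - (y\<^sup>2 / 4) + 3 * x))"

lemma rewritten_system_coords_0:
  "\<exists>F. polynomial_system F \<and> rewritten_system rhs (coords ! 0) F"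
proof (intro exI conjI)
  show "polynomial_system rhs"
    by (rule polynomial_systemI[of _ 1 1 1 "- 1 / 4" 0 2 3 1 0]) (simp add: rhs_def)
  have "(coords ! 0 has_derivative id) (at z)" for z
    by (simp add: coords_def id_def)
  then show "rewritten_system rhs (coords ! 0) rhs"
    unfolding rewritten_system_def
    by (intro allI generically_off_axis exI[of _ id]) (auto simp: coords_def)
qed

lemma rewritten_system_coords_1:
  "\<exists>F. polynomial_system F \<and> rewritten_system rhs (coords ! 1) F"
proof (intro exI conjI)
  \<comment> \<open>The chain rule gives
    \<open>x\<^sub>1' = 3 * (x - y\<^sup>2 / 4)\<^sup>2\<close>, where the bracket is
    \<open>x\<^sub>1 * y\<^sub>1\<close>, and \<open>y\<^sub>1' = 1 / 4 - 3 * x / y\<^sup>2\<close>,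
    where substituting x contributes the constant -3/4.\<close>
  let ?F = "(\<lambda>t (x, y). (3 * x\<^sup>2 * y\<^sup>2, - 1 / 2 - 3 * x * y ^ 3)) :: complex \<Rightarrow> plane \<Rightarrow> plane"
  show "polynomial_system ?F"
    by (rule polynomial_systemI[of _ 3 2 2 "- 1 / 2" 0 0 "- 3" 1 3]) simp
  have "\<exists>D. (coords ! 1 has_derivative D) (at z) \<and> D (rhs t z) = ?F t ((coords ! 1) z)"
    if "snd z \<noteq> 0" for t z
  proof (intro exI conjI)
    show "(coords ! 1 has_derivative (\<lambda>v. ((fst v - snd z * snd v / 2) * snd z +
        (fst z - (snd z)\<^sup>2 / 4) * snd v, - (snd v / (snd z)\<^sup>2)))) (at z)"
      using that unfolding coords_def case_prod_beta
      by (auto intro!: derivative_eq_intros simp: field_simps power2_eq_square)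
    show "((fst (rhs t z) - snd z * snd (rhs t z) / 2) * snd z +
        (fst z - (snd z)\<^sup>2 / 4) * snd (rhs t z), - (snd (rhs t z) / (snd z)\<^sup>2)) =
        ?F t ((coords ! 1) z)"
      using that by (cases z) (simp add: rhs_def coords_def field_simps eval_nat_numeral)
  qed
  then show "rewritten_system rhs (coords ! 1) ?F"
    unfolding rewritten_system_def by (intro allI generically_off_axis)
qed

lemma rewritten_system_coords_2:
  "\<exists>F. polynomial_system F \<and> rewritten_system rhs (coords ! 2) F"
proof (intro exI conjI)
  \<comment> \<open>In the derivative of \<open>x * y ^ 4\<close> the terms \<open>x * y ^ 5\<close>
    cancel, thanks to the exponent 4, and \<open>12 * x\<^sup>2 * y ^ 3\<close> remains.\<close>
  let ?F = "(\<lambda>t (x, y). (12 * x\<^sup>2 * y ^ 5, 1 / 4 - 3 * x * y ^ 6)) :: complex \<Rightarrow> plane \<Rightarrow> plane"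
  show "polynomial_system ?F"
    by (rule polynomial_systemI[of _ 12 2 5 "1 / 4" 0 0 "- 3" 1 6]) simp
  have "\<exists>D. (coords ! 2 has_derivative D) (at z) \<and> D (rhs t z) = ?F t ((coords ! 2) z)"
    if "snd z \<noteq> 0" for t z
  proof (intro exI conjI)
    show "(coords ! 2 has_derivative (\<lambda>v. (fst v * snd z ^ 4 + 4 * fst z * snd z ^ 3 * snd v,
        - (snd v / (snd z)\<^sup>2)))) (at z)"
      using that unfolding coords_def case_prod_beta
      by (auto intro!: derivative_eq_intros simp: field_simps power2_eq_square)
    show "(fst (rhs t z) * snd z ^ 4 + 4 * fst z * snd z ^ 3 * snd (rhs t z),
        - (snd (rhs t z) / (snd z)\<^sup>2)) = ?F t ((coords ! 2) z)"
      using that by (cases z) (simp add: rhs_def coords_def field_simps eval_nat_numeral)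
  qed
  then show "rewritten_system rhs (coords ! 2) ?F"
    unfolding rewritten_system_def by (intro allI generically_off_axis)
qed

section \<open>Extension of meromorphic solutions\<close>

lemma isCont_center:
  fixes f :: "complex \<Rightarrow> complex"
  assumes "f holomorphic_on ball z r" and "r > 0"
  shows "isCont f z"
  using assms holomorphic_on_imp_continuous_on continuous_on_eq_continuous_at[OF open_ball]
  by force

text \<open>If \<open>f\<close> is not zero near \<open>z\<close>, the leading Laurent term is split
  off. The bound \<open>R\<close> keeps the disc inside one on which the differential equations
  hold.\<close>

lemma meromorphic_factor:
  assumes "f meromorphic_on {z}" and "R > 0"
  obtains r where "0 < r" "r \<le> R" "\<And>t. t \<in> ball z r - {z} \<Longrightarrow> f t = 0"
  | r n g where "0 < r" "r \<le> R" "g holomorphic_on ball z r" "\<And>t. t \<in> ball z r \<Longrightarrow> g t \<noteq> 0"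
    "\<And>t. t \<in> ball z r - {z} \<Longrightarrow> f t = (t - z) powi n * g t"
proof (cases "\<exists>\<^sub>F w in at z. f w \<noteq> 0")
  case True
  from assms(1) have "isolated_singularity_at f z" "not_essential f z"
    by (simp_all add: meromorphic_at_iff)
  from zorder_exist[OF this True] obtain r where r: "zor_poly f z z \<noteq> 0" "r > 0"
    "zor_poly f z holomorphic_on cball z r"
    "\<And>w. w \<in> cball z r - {z} \<Longrightarrow> f w = zor_poly f z w * (w - z) powi zorder f z \<and> zor_poly f z w \<noteq> 0"
    by blast
  show ?thesis
  proof (rule that(2)[of "min r R"])
    show "zor_poly f z holomorphic_on ball z (min r R)"
      by (rule holomorphic_on_subset[OF r(3)]) auto
    show "zor_poly f z t \<noteq> 0" if "t \<in> ball z (min r R)" for t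
      using r(1) r(4)[of t] that by (cases "t = z") auto
    show "f t = (t - z) powi zorder f z * zor_poly f z t" if "t \<in> ball z (min r R) - {z}" for t
      using r(4)[of t] that by (simp add: mult.commute)
  qed (use r assms(2) in auto)
next
  case False
  then have "\<forall>\<^sub>F w in at z. f w = 0"
    by (simp add: not_frequently)
  then obtain d where "d > 0" "\<And>w. w \<noteq> z \<Longrightarrow> dist w z < d \<Longrightarrow> f w = 0"
    unfolding eventually_at by auto
  then show ?thesis
    using assms(2) by (intro that(1)[of "min d R"]) (auto simp: dist_commute)
qed

text \<open>The equation is known only off \<open>z\<close>, so limits are compared. The factor
  \<open>0 powi n\<close> is 1 for \<open>n = 0\<close> and 0 for positive \<open>n\<close>.\<close>

lemma powi_equation_nonneg:
  fixes A B :: "complex \<Rightarrow> complex"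
  assumes "isCont A z" "isCont B z" "r > 0" "n \<ge> 0"
    and eq: "\<And>t. t \<in> ball z r - {z} \<Longrightarrow> A t = (t - z) powi n * B t"
  shows "A z = 0 powi n * B z"
proof -
  have "isCont (\<lambda>t. (t - z) ^ nat n * B t) z"
    using assms(2) by (intro continuous_intros)
  then have "((\<lambda>t. (t - z) ^ nat n * B t) \<longlongrightarrow> 0 ^ nat n * B z) (at z)"
    by (simp add: isCont_def)
  moreover have "\<forall>\<^sub>F t in at z. (t - z) ^ nat n * B t = A t"
    unfolding eventually_at using assms(3,4) eq
    by (intro exI[of _ r]) (auto simp: dist_commute power_int_def)
  ultimately have "(A \<longlongrightarrow> 0 ^ nat n * B z) (at z)"
    by (rule Lim_transform_eventually)
  moreover have "(A \<longlongrightarrow> A z) (at z)"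
    using assms(1) by (simp add: isCont_def)
  ultimately have "A z = 0 ^ nat n * B z"
    using LIM_unique by blast
  with \<open>n \<ge> 0\<close> show ?thesis
    by (simp add: power_int_def)
qed

text \<open>Comparison of leading orders, by which the differential equations restrict the
  exponents. For negative \<open>n\<close> the roles of \<open>A\<close> and \<open>B\<close> are
  exchanged.\<close>

lemma powi_equation:
  fixes A B :: "complex \<Rightarrow> complex"
  assumes "isCont A z" "isCont B z" "r > 0"
    and eq: "\<And>t. t \<in> ball z r - {z} \<Longrightarrow> A t = (t - z) powi n * B t"
  shows "n > 0 \<Longrightarrow> A z = 0" "n = 0 \<Longrightarrow> A z = B z" "n < 0 \<Longrightarrow> B z = 0"
proof -
  show "A z = 0" if "n > 0"
    using powi_equation_nonneg[OF assms(1-3) _ eq] that by simp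
  show "A z = B z" if "n = 0"
    using powi_equation_nonneg[OF assms(1-3) _ eq] that by simp
  have "B t = (t - z) powi (- n) * A t" if "t \<in> ball z r - {z}" for t
    using eq[OF that] that by (simp add: power_int_minus field_simps)
  then show "B z = 0" if "n < 0"
    using powi_equation_nonneg[OF assms(2,1,3), of "- n"] that by simp
qed

text \<open>The product rule, multiplied by \<open>t - z\<close> so that the exponent
  \<open>n - 1\<close> becomes \<open>n\<close>.\<close>

lemma powi_factor_derivative:
  assumes "g holomorphic_on ball z r" and t: "t \<in> ball z r - {z}"
    and f: "\<And>t. t \<in> ball z r - {z} \<Longrightarrow> f t = (t - z) powi n * g t"
    and f': "(f has_field_derivative f') (at t)"
  shows "f' * (t - z) = (t - z) powi n * (of_int n * g t + (t - z) * deriv g t)"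
proof -
  have g': "(g has_field_derivative deriv g t) (at t)"
    using assms(1) t by (intro holomorphic_derivI) auto
  have "((\<lambda>t. (t - z) powi n * g t) has_field_derivative
      (of_int n * (t - z) powi (n - 1) * g t + (t - z) powi n * deriv g t)) (at t)"
    using t by (auto intro!: derivative_eq_intros g')
  then have "(f has_field_derivative
      (of_int n * (t - z) powi (n - 1) * g t + (t - z) powi n * deriv g t)) (at t)"
    by (rule has_field_derivative_transform_within_open[of _ _ _ "ball z r - {z}"])
      (use t f in auto)
  from DERIV_unique[OF f' this] show ?thesis
    using t by (simp add: power_int_diff field_simps)
qed

text \<open>One chart serves the whole disc. In charts 1 and 2 the condition
  \<open>y t \<noteq> 0\<close> ensures that the point is glued to the original point of chart
  0.\<close>

definition extends_to_charts :: "complex \<Rightarrow> (complex \<Rightarrow> complex) \<Rightarrow> (complex \<Rightarrow> complex) \<Rightarrow> bool" where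
  "extends_to_charts t\<^sub>0 x y \<longleftrightarrow> (\<exists>j<3. \<exists>r>0. \<exists>u v. u holomorphic_on ball t\<^sub>0 r \<and>
     v holomorphic_on ball t\<^sub>0 r \<and>
     (\<forall>t\<in>ball t\<^sub>0 r - {t\<^sub>0}. (j = 0 \<or> y t \<noteq> 0) \<and> (u t, v t) = (coords ! j) (x t, y t)))"

lemma extends_to_chartsI:
  assumes "j < 3" "r > 0" "u holomorphic_on ball t\<^sub>0 r" "v holomorphic_on ball t\<^sub>0 r"
    and "\<And>t. t \<in> ball t\<^sub>0 r - {t\<^sub>0} \<Longrightarrow> (j = 0 \<or> y t \<noteq> 0) \<and> (u t, v t) = (coords ! j) (x t, y t)"
  shows "extends_to_charts t\<^sub>0 x y"
  using assms unfolding extends_to_charts_def by blast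

lemma nonzero_ball:
  fixes w :: "complex \<Rightarrow> complex"
  assumes "w holomorphic_on ball z r" "r > 0" "w z \<noteq> 0"
  obtains e where "0 < e" "e \<le> r" "\<And>t. t \<in> ball z e \<Longrightarrow> w t \<noteq> 0"
proof -
  have "isCont w z"
    using assms(1,2) by (rule isCont_center)
  then obtain e where "e > 0" "\<And>t. dist z t < e \<Longrightarrow> w t \<noteq> 0"
    using continuous_at_avoid[of z w 0] assms(3) by auto
  then show ?thesis
    using assms(2) by (intro that[of "min e r"]) auto
qed

text \<open>The remaining equation \<open>y' = - y\<^sup>2 / 4\<close> allows only simple poles,
  which chart 2 resolves with first coordinate 0.\<close>

lemma extends_if_x_zero:
  assumes "y meromorphic_on {t\<^sub>0}" "R > 0"
    and x: "\<And>t. t \<in> ball t\<^sub>0 R - {t\<^sub>0} \<Longrightarrow> x t = 0"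
    and y': "\<And>t. t \<in> ball t\<^sub>0 R - {t\<^sub>0} \<Longrightarrow> (y has_field_derivative - ((y t)\<^sup>2 / 4)) (at t)"
  shows "extends_to_charts t\<^sub>0 x y"
  using assms(1,2)
proof (cases rule: meromorphic_factor)
  case (1 r)
  then show ?thesis
    using x by (intro extends_to_chartsI[of 0 r "\<lambda>_. 0" _ "\<lambda>_. 0"]) (auto simp: coords_def)
next
  case (2 r k g)
  have cont: "isCont g t\<^sub>0" "isCont (deriv g) t\<^sub>0"
    using 2(1,3) holomorphic_deriv[OF 2(3)]
    by (auto intro: isCont_center)
  have eq: "of_int k * g t + (t - t\<^sub>0) * deriv g t = (t - t\<^sub>0) powi (k + 1) * (- ((g t)\<^sup>2 / 4))"
    if t: "t \<in> ball t\<^sub>0 r - {t\<^sub>0}" for t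
  proof -
    have "t \<in> ball t\<^sub>0 R - {t\<^sub>0}"
      using t 2(2) by auto
    note powi_factor_derivative[OF 2(3) t 2(5) y'[OF this]]
    then have "(t - t\<^sub>0) powi k * (of_int k * g t + (t - t\<^sub>0) * deriv g t) =
        (t - t\<^sub>0) powi k * ((t - t\<^sub>0) powi (k + 1) * (- ((g t)\<^sup>2 / 4)))"
      using t 2(5)[OF t] by (simp add: power_int_add power2_eq_square mult_ac)
    then show ?thesis
      by (rule mult_left_cancel[THEN iffD1, rotated]) (use t in simp)
  qed
  note lim = powi_equation[OF _ _ 2(1) eq]
  have A: "isCont (\<lambda>t. of_int k * g t + (t - t\<^sub>0) * deriv g t) t\<^sub>0"
    and B: "isCont (\<lambda>t. - ((g t)\<^sup>2 / 4)) t\<^sub>0"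
    using cont by (auto intro!: continuous_intros)
  have g0: "g t\<^sub>0 \<noteq> 0"
    using 2(1,4) by simp
  \<comment> \<open>An exponent above -1 forces \<open>k * g t\<^sub>0 = 0\<close>, hence
    \<open>k = 0\<close>; one below -1 forces \<open>g t\<^sub>0 = 0\<close>, which is
    excluded.\<close>
  consider "k = 0" | "k = - 1"
    using lim(1)[OF A B] lim(3)[OF A B] g0 by fastforce
  then show ?thesis
  proof cases
    case 1
    show ?thesis
      by (rule extends_to_chartsI[of 0 r "\<lambda>_. 0" _ g]) (use 2 1 x in \<open>auto simp: coords_def\<close>)
  next
    case k: 2
    show ?thesis
    proof (rule extends_to_chartsI[of 2 r "\<lambda>_. 0" _ "\<lambda>t. (t - t\<^sub>0) / g t"])
      fix t
      assume t: "t \<in> ball t\<^sub>0 r - {t\<^sub>0}"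
      then have "x t = 0" "y t = g t / (t - t\<^sub>0)" "g t \<noteq> 0" "t \<noteq> t\<^sub>0"
        using 2(2,4,5) k x by (auto simp: power_int_minus divide_inverse)
      then show "(2 = 0 \<or> y t \<noteq> 0) \<and> (0, (t - t\<^sub>0) / g t) = (coords ! 2) (x t, y t)"
        by (simp add: coords_def)
    qed (use 2 in \<open>auto intro!: holomorphic_intros\<close>)
  qed
qed

text \<open>
  A pole of \<open>y\<close> with residue \<open>- 2\<close>: \<open>x\<^sub>1 = (x - y\<^sup>2 / 4) y\<close> has a pole of order at most \<open>2\<close>, and
  \<open>x\<^sub>1' = 3 (x\<^sub>1 / y)\<^sup>2\<close> then leaves no room for a pole.
\<close>

lemma extends_if_double_pole:
  assumes x: "x meromorphic_on {t\<^sub>0}" "\<And>t. t \<in> ball t\<^sub>0 R - {t\<^sub>0} \<Longrightarrow> x t = (t - t\<^sub>0) powi (- 2) * g t"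
    and y: "y meromorphic_on {t\<^sub>0}" "\<And>t. t \<in> ball t\<^sub>0 R - {t\<^sub>0} \<Longrightarrow> y t * (t - t\<^sub>0) = w t"
    and "R > 0" "g holomorphic_on ball t\<^sub>0 R" "g t\<^sub>0 = 1"
    and w: "w holomorphic_on ball t\<^sub>0 R" "\<And>t. t \<in> ball t\<^sub>0 R \<Longrightarrow> w t \<noteq> 0" "w t\<^sub>0 = - 2"
    and x': "\<And>t. t \<in> ball t\<^sub>0 R - {t\<^sub>0} \<Longrightarrow> (x has_field_derivative x t * y t) (at t)"
    and y': "\<And>t. t \<in> ball t\<^sub>0 R - {t\<^sub>0} \<Longrightarrow>
      (y has_field_derivative - ((y t)\<^sup>2 / 4) + 3 * x t) (at t)"
  shows "extends_to_charts t\<^sub>0 x y"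
proof -
  define f where "f t = (x t - (y t)\<^sup>2 / 4) * y t" for t
  have y_w: "y t = w t / (t - t\<^sub>0)" "y t \<noteq> 0" if "t \<in> ball t\<^sub>0 R - {t\<^sub>0}" for t
    using y(2)[OF that] w(2)[of t] that by (auto simp: field_simps)
  have v: "(\<lambda>t. (t - t\<^sub>0) / w t) holomorphic_on ball t\<^sub>0 R"
    using w by (auto intro!: holomorphic_intros)
  have extends: "extends_to_charts t\<^sub>0 x y"
    if "0 < r" "r \<le> R" "u holomorphic_on ball t\<^sub>0 r" "\<And>t. t \<in> ball t\<^sub>0 r - {t\<^sub>0} \<Longrightarrow> f t = u t" for r u
  proof (rule extends_to_chartsI[of 1 r u _ "\<lambda>t. (t - t\<^sub>0) / w t"])
    show "(\<lambda>t. (t - t\<^sub>0) / w t) holomorphic_on ball t\<^sub>0 r"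
      by (rule holomorphic_on_subset[OF v]) (use that in auto)
    fix t
    assume t: "t \<in> ball t\<^sub>0 r - {t\<^sub>0}"
    then have "t \<in> ball t\<^sub>0 R - {t\<^sub>0}"
      using that(2) by auto
    from y_w[OF this] show "(1 = 0 \<or> y t \<noteq> 0) \<and> (u t, (t - t\<^sub>0) / w t) = (coords ! 1) (x t, y t)"
      using that(4)[OF t] by (simp add: coords_def f_def)
  qed (use that in auto)
  have "f meromorphic_on {t\<^sub>0}"
    unfolding f_def by (intro meromorphic_intros x y)
  then show ?thesis
    using \<open>R > 0\<close>
  proof (cases rule: meromorphic_factor)
    case (1 r)
    then show ?thesis
      by (intro extends[of r "\<lambda>_. 0"]) auto
  next
    case (2 r m q)
    have cont: "isCont q t\<^sub>0" "isCont (deriv q) t\<^sub>0" "isCont g t\<^sub>0" "isCont w t\<^sub>0"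
      using 2(1,3) holomorphic_deriv[OF 2(3)] assms(5,6) w(1)
      by (auto intro: isCont_center)
    have q0: "q t\<^sub>0 \<noteq> 0"
      using 2(1,4) by simp
    have sub: "t \<in> ball t\<^sub>0 R - {t\<^sub>0}" if "t \<in> ball t\<^sub>0 r - {t\<^sub>0}" for t
      using that 2(2) by auto
    \<comment> \<open>With \<open>s = t - t\<^sub>0\<close>, both terms of \<open>f\<close> have at
      most a triple pole, so \<open>s ^ 3 * f\<close> is expressed by the regular functions
      \<open>g\<close> and \<open>w\<close>.\<close>
    have eq: "(g t - (w t)\<^sup>2 / 4) * w t = (t - t\<^sub>0) powi (m + 3) * q t"
      if t: "t \<in> ball t\<^sub>0 r - {t\<^sub>0}" for t
    proof -
      have *: "(a - b\<^sup>2 / 4) * b = s ^ 3 * ((a / s\<^sup>2 - (b / s)\<^sup>2 / 4) * (b / s))"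
        if "s \<noteq> 0" for a b s :: complex
        using that by (simp add: field_simps eval_nat_numeral)
      have "x t = g t / (t - t\<^sub>0)\<^sup>2"
        using x(2)[OF sub[OF t]] by (simp add: power_int_minus divide_inverse)
      then have "(g t - (w t)\<^sup>2 / 4) * w t = (t - t\<^sub>0) ^ 3 * f t"
        using *[of "t - t\<^sub>0" "g t" "w t"] y_w(1)[OF sub[OF t]] t by (simp add: f_def)
      also have "\<dots> = (t - t\<^sub>0) powi (m + 3) * q t"
        using 2(5)[OF t] t by (simp add: power_int_add)
      finally show ?thesis .
    qed
    have A: "isCont (\<lambda>t. (g t - (w t)\<^sup>2 / 4) * w t) t\<^sub>0"
      using cont by (auto intro!: continuous_intros)
    \<comment> \<open>The left side of \<open>eq\<close> vanishes at \<open>t\<^sub>0\<close>, since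
      \<open>1 - (-2)\<^sup>2 / 4 = 0\<close>. An exponent \<open>m + 3 \<le> 0\<close> would
      therefore force \<open>q t\<^sub>0 = 0\<close>.\<close>
    have m: "m + 3 > 0"
      using powi_equation(2,3)[OF A cont(1) 2(1) eq] q0 assms(7) w(3) by fastforce
    \<comment> \<open>This is the equation \<open>f' = 3 * (f / y)\<^sup>2\<close> of chart 1 with
      \<open>f\<close> and \<open>y\<close> replaced by their factored forms.\<close>
    have eq': "of_int m * q t + (t - t\<^sub>0) * deriv q t =
        (t - t\<^sub>0) powi (m + 3) * (3 * (q t)\<^sup>2 / (w t)\<^sup>2)"
      if t: "t \<in> ball t\<^sub>0 r - {t\<^sub>0}" for t
    proof -
      have "(f has_field_derivative 3 * (f t / y t)\<^sup>2) (at t)"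
        unfolding f_def
        by (rule derivative_eq_intros x'[OF sub[OF t]] y'[OF sub[OF t]] refl | simp)+
          (use y_w(2)[OF sub[OF t]] in \<open>simp add: field_simps power2_eq_square\<close>)
      then have deriv: "3 * (f t / y t)\<^sup>2 * (t - t\<^sub>0) =
          (t - t\<^sub>0) powi m * (of_int m * q t + (t - t\<^sub>0) * deriv q t)"
        by (rule powi_factor_derivative[OF 2(3) t 2(5), rotated])
      have quot: "f t / y t = (t - t\<^sub>0) powi (m + 1) * q t / w t"
        using 2(5)[OF t] y_w[OF sub[OF t]] t by (simp add: power_int_add)
      have pow: "((t - t\<^sub>0) powi (m + 1))\<^sup>2 * (t - t\<^sub>0) = (t - t\<^sub>0) powi m * (t - t\<^sub>0) powi (m + 3)"
        using t by (simp add: power_int_add eval_nat_numeral)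
      have "(t - t\<^sub>0) powi m * (of_int m * q t + (t - t\<^sub>0) * deriv q t) =
          (((t - t\<^sub>0) powi (m + 1))\<^sup>2 * (t - t\<^sub>0)) * (3 * (q t)\<^sup>2 / (w t)\<^sup>2)"
        unfolding deriv[symmetric] quot by (simp add: power_mult_distrib power_divide)
      then have "(t - t\<^sub>0) powi m * (of_int m * q t + (t - t\<^sub>0) * deriv q t) =
          (t - t\<^sub>0) powi m * ((t - t\<^sub>0) powi (m + 3) * (3 * (q t)\<^sup>2 / (w t)\<^sup>2))"
        unfolding pow by (simp only: mult.assoc)
      then show ?thesis
        by (rule mult_left_cancel[THEN iffD1, rotated]) (use t in simp)
    qed
    \<comment> \<open>As the exponent \<open>m + 3\<close> is positive, the right side of
      \<open>eq'\<close> tends to 0; this leaves \<open>m * q t\<^sub>0 = 0\<close>.\<close>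
    have "of_int m * q t\<^sub>0 + (t\<^sub>0 - t\<^sub>0) * deriv q t\<^sub>0 = 0"
      by (rule powi_equation(1)[OF _ _ 2(1) eq' m])
        (use cont w(3) in \<open>auto intro!: continuous_intros\<close>)
    with q0 have "m = 0"
      by simp
    with 2 show ?thesis
      by (intro extends[of r q]) auto
  qed
qed

text \<open>The first equation makes y the logarithmic derivative of x, so y has at most a simple
  pole with residue \<open>n\<close>; the second equation then restricts \<open>n\<close>.\<close>

lemma extends_if_x_nonzero:
  assumes mero: "x meromorphic_on {t\<^sub>0}" "y meromorphic_on {t\<^sub>0}"
    and "r > 0" and g: "g holomorphic_on ball t\<^sub>0 r" "\<And>t. t \<in> ball t\<^sub>0 r \<Longrightarrow> g t \<noteq> 0"
    and x: "\<And>t. t \<in> ball t\<^sub>0 r - {t\<^sub>0} \<Longrightarrow> x t = (t - t\<^sub>0) powi n * g t"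
    and x': "\<And>t. t \<in> ball t\<^sub>0 r - {t\<^sub>0} \<Longrightarrow> (x has_field_derivative x t * y t) (at t)"
    and y': "\<And>t. t \<in> ball t\<^sub>0 r - {t\<^sub>0} \<Longrightarrow>
      (y has_field_derivative - ((y t)\<^sup>2 / 4) + 3 * x t) (at t)"
  shows "extends_to_charts t\<^sub>0 x y"
proof -
  define h where "h t = deriv g t / g t" for t
  define w where "w t = of_int n + (t - t\<^sub>0) * h t" for t
  have h: "h holomorphic_on ball t\<^sub>0 r"
    unfolding h_def using g by (auto intro!: holomorphic_intros holomorphic_deriv)
  have w: "w holomorphic_on ball t\<^sub>0 r" "w t\<^sub>0 = of_int n"
    unfolding w_def using h by (auto intro!: holomorphic_intros)
  have cont: "isCont g t\<^sub>0" "isCont (deriv h) t\<^sub>0" "isCont w t\<^sub>0"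
    using \<open>r > 0\<close> g(1) holomorphic_deriv[OF h] w(1)
    by (auto intro: isCont_center)
  have yw: "y t * (t - t\<^sub>0) = w t" if t: "t \<in> ball t\<^sub>0 r - {t\<^sub>0}" for t
  proof -
    have "(t - t\<^sub>0) powi n * (g t * (y t * (t - t\<^sub>0))) =
        (t - t\<^sub>0) powi n * (of_int n * g t + (t - t\<^sub>0) * deriv g t)"
      using powi_factor_derivative[OF g(1) t x x'[OF t]] x[OF t] by (simp add: mult.assoc)
    then have "g t * (y t * (t - t\<^sub>0)) = of_int n * g t + (t - t\<^sub>0) * deriv g t"
      using t by simp
    then show ?thesis
      using g(2)[of t] t by (simp add: w_def h_def field_simps)
  qed
  have y_h: "y t = of_int n / (t - t\<^sub>0) + h t" if "t \<in> ball t\<^sub>0 r - {t\<^sub>0}" for t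
    using yw[OF that] that by (simp add: w_def field_simps)
  \<comment> \<open>The second equation multiplied by the square of \<open>t - t\<^sub>0\<close>,
    with \<open>(t - t\<^sub>0) * y = w\<close> and
    \<open>y = n / (t - t\<^sub>0) + h\<close>.\<close>
  have eq: "(w t)\<^sup>2 / 4 - of_int n + (t - t\<^sub>0)\<^sup>2 * deriv h t = (t - t\<^sub>0) powi (n + 2) * (3 * g t)"
    if t: "t \<in> ball t\<^sub>0 r - {t\<^sub>0}" for t
  proof -
    have "(h has_field_derivative deriv h t) (at t)"
      using h t by (intro holomorphic_derivI) auto
    then have "((\<lambda>t. of_int n / (t - t\<^sub>0) + h t) has_field_derivative
        - of_int n / (t - t\<^sub>0)\<^sup>2 + deriv h t) (at t)"
      using t by (auto intro!: derivative_eq_intros simp: power2_eq_square)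
    then have "(y has_field_derivative - of_int n / (t - t\<^sub>0)\<^sup>2 + deriv h t) (at t)"
      by (rule has_field_derivative_transform_within_open[of _ _ _ "ball t\<^sub>0 r - {t\<^sub>0}"])
        (use t y_h in auto)
    from DERIV_unique[OF y'[OF t] this]
    have c: "(t - t\<^sub>0)\<^sup>2 * (- ((y t)\<^sup>2 / 4) + 3 * x t) = - of_int n + (t - t\<^sub>0)\<^sup>2 * deriv h t"
      using t by (simp add: field_simps)
    have a: "(t - t\<^sub>0)\<^sup>2 * x t = (t - t\<^sub>0) powi (n + 2) * g t"
      using x[OF t] t by (simp add: power_int_add)
    have b: "(t - t\<^sub>0)\<^sup>2 * (y t)\<^sup>2 = (w t)\<^sup>2"
      using yw[OF t] by (simp flip: power_mult_distrib add: mult.commute)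
    have "(t - t\<^sub>0)\<^sup>2 * (- ((y t)\<^sup>2 / 4) + 3 * x t) =
        - ((w t)\<^sup>2 / 4) + 3 * ((t - t\<^sub>0) powi (n + 2) * g t)"
      unfolding a[symmetric] b[symmetric] by (simp add: algebra_simps)
    from trans[OF c[symmetric] this] show ?thesis
      by (simp add: algebra_simps)
  qed
  have A: "isCont (\<lambda>t. (w t)\<^sup>2 / 4 - of_int n + (t - t\<^sub>0)\<^sup>2 * deriv h t) t\<^sub>0"
    and B: "isCont (\<lambda>t. 3 * g t) t\<^sub>0"
    using cont by (auto intro!: continuous_intros)
  note lim = powi_equation[OF A B \<open>r > 0\<close> eq]
  have g0: "g t\<^sub>0 \<noteq> 0"
    using g(2) \<open>r > 0\<close> by simp
  \<comment> \<open>For positive \<open>n + 2\<close> the value at \<open>t\<^sub>0\<close> is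
    \<open>n\<^sup>2 / 4 - n = 0\<close>.\<close>
  have roots: "n = 0 \<or> n = 4" if "n + 2 > 0"
  proof -
    have "of_int (n * (n - 4)) = (0 :: complex)"
      using lim(1)[OF _ that] w(2) by (simp add: field_simps power2_eq_square)
    then show ?thesis
      unfolding of_int_eq_0_iff by simp
  qed
  have "\<not> n + 2 < 0"
    using lim(3) g0 by auto
  then consider "n = 0" | "n = 4" | "n = - 2"
    using roots by linarith
  then show ?thesis
  proof cases
    case 1
    show ?thesis
      by (rule extends_to_chartsI[of 0 r g _ h])
        (use \<open>r > 0\<close> g h x y_h 1 in \<open>auto simp: coords_def\<close>)
  next
    case 2
    obtain e where e: "0 < e" "e \<le> r" "\<And>t. t \<in> ball t\<^sub>0 e \<Longrightarrow> w t \<noteq> 0"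
      using nonzero_ball[OF w(1) \<open>r > 0\<close>] w(2) 2 by auto
    have sub: "ball t\<^sub>0 e \<subseteq> ball t\<^sub>0 r"
      using e(2) by auto
    show ?thesis
    \<comment> \<open>The fourfold zero of x cancels the pole of \<open>y ^ 4\<close>, so the first
      coordinate of chart 2 is \<open>g * w ^ 4\<close>; \<open>w\<close> is nonzero near
      \<open>t\<^sub>0\<close> because \<open>w t\<^sub>0 = 4\<close>.\<close>
    proof (rule extends_to_chartsI[of 2 e "\<lambda>t. g t * w t ^ 4" _ "\<lambda>t. (t - t\<^sub>0) / w t"])
      show "(\<lambda>t. g t * w t ^ 4) holomorphic_on ball t\<^sub>0 e" "(\<lambda>t. (t - t\<^sub>0) / w t) holomorphic_on ball t\<^sub>0 e"
        using holomorphic_on_subset[OF g(1) sub] holomorphic_on_subset[OF w(1) sub] e(3)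
        by (auto intro!: holomorphic_intros)
      fix t
      assume t: "t \<in> ball t\<^sub>0 e - {t\<^sub>0}"
      then have t': "t \<in> ball t\<^sub>0 r - {t\<^sub>0}"
        using sub by blast
      have "y t = w t / (t - t\<^sub>0)" "w t \<noteq> 0" "t - t\<^sub>0 \<noteq> 0"
        using yw[OF t'] e(3)[of t] t by (auto simp: field_simps)
      then show "(2 = 0 \<or> y t \<noteq> 0) \<and> (g t * w t ^ 4, (t - t\<^sub>0) / w t) = (coords ! 2) (x t, y t)"
        using x[OF t'] 2 by (simp add: coords_def power_divide)
    qed (use e in auto)
  next
    case 3
    obtain e where e: "0 < e" "e \<le> r" "\<And>t. t \<in> ball t\<^sub>0 e \<Longrightarrow> w t \<noteq> 0"
      using nonzero_ball[OF w(1) \<open>r > 0\<close>] w(2) 3 by auto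
    have sub: "ball t\<^sub>0 e \<subseteq> ball t\<^sub>0 r"
      using e(2) by auto
    \<comment> \<open>At exponent 0 the comparison reads \<open>1 + 2 = 3 * g t\<^sub>0\<close>,
      because \<open>w t\<^sub>0 = - 2\<close>.\<close>
    have "g t\<^sub>0 = 1"
      using lim(2)[OF _ _] 3 w(2) by simp
    show ?thesis
    proof (rule extends_if_double_pole[OF mero(1) _ mero(2) _ e(1)])
      show "g holomorphic_on ball t\<^sub>0 e" "w holomorphic_on ball t\<^sub>0 e"
        using holomorphic_on_subset[OF _ sub] g(1) w(1) by blast+
      fix t
      assume "t \<in> ball t\<^sub>0 e - {t\<^sub>0}"
      then have t: "t \<in> ball t\<^sub>0 r - {t\<^sub>0}"
        using sub by blast
      show "x t = (t - t\<^sub>0) powi (- 2) * g t"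
        using x[OF t] 3 by simp
      show "y t * (t - t\<^sub>0) = w t"
        by (rule yw[OF t])
      show "(x has_field_derivative x t * y t) (at t)"
        by (rule x'[OF t])
      show "(y has_field_derivative - ((y t)\<^sup>2 / 4) + 3 * x t) (at t)"
        by (rule y'[OF t])
    qed (use \<open>g t\<^sub>0 = 1\<close> w(2) 3 e(3) in auto)
  qed
qed

section \<open>Meromorphic solutions as holomorphic curves in the glued space\<close>

lemma meromorphic_solution_extends:
  assumes "meromorphic_solution_near rhs t\<^sub>0 x y"
  shows "extends_to_charts t\<^sub>0 x y"
proof -
  have mero: "x meromorphic_on {t\<^sub>0}" "y meromorphic_on {t\<^sub>0}"
    and "\<forall>\<^sub>F t in at t\<^sub>0. (x has_field_derivative x t * y t) (at t) \<and>
      (y has_field_derivative - ((y t)\<^sup>2 / 4) + 3 * x t) (at t)"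
    using assms by (simp_all add: meromorphic_solution_near_def rhs_def)
  then obtain R where "R > 0" and R: "\<And>t. t \<noteq> t\<^sub>0 \<Longrightarrow> dist t t\<^sub>0 < R \<Longrightarrow>
      (x has_field_derivative x t * y t) (at t) \<and>
      (y has_field_derivative - ((y t)\<^sup>2 / 4) + 3 * x t) (at t)"
    unfolding eventually_at by auto
  have ode: "(x has_field_derivative x t * y t) (at t)"
      "(y has_field_derivative - ((y t)\<^sup>2 / 4) + 3 * x t) (at t)"
    if "r \<le> R" "t \<in> ball t\<^sub>0 r - {t\<^sub>0}" for r t
    using R[of t] that by (auto simp: dist_commute)
  from mero(1) \<open>R > 0\<close> show ?thesis
  proof (cases rule: meromorphic_factor)
    case (1 r)
    show ?thesis
      by (rule extends_if_x_zero[OF mero(2) 1(1,3)]) (use ode(2)[OF 1(2)] 1(3) in auto)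
  next
    case (2 r n g)
    show ?thesis
      by (rule extends_if_x_nonzero[OF mero 2(1,3,4,5)]) (use ode[OF 2(2)] in auto)
  qed
qed

lemma transition_0: "transition 0 j z = (coords ! j) z"
  by (auto simp: transition_def coords_def coords_inv_def)

text \<open>The curve is \<open>chart coords j\<close> applied to the extended coordinates on the
  whole disc; off the centre the gluing identifies it with the original solution.\<close>

lemma holomorphic_curve_if_extends:
  assumes "extends_to_charts t\<^sub>0 x y"
  shows "\<exists>r>0. \<exists>\<Phi>. holomorphic_curve_on coords \<Phi> (ball t\<^sub>0 r) \<and>
    (\<forall>t\<in>ball t\<^sub>0 r - {t\<^sub>0}. \<Phi> t = chart coords 0 ((x t, y t), t))"
proof -
  obtain j r u v where j: "j < 3" and "r > 0"
    and hol: "u holomorphic_on ball t\<^sub>0 r" "v holomorphic_on ball t\<^sub>0 r"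
    and eq: "\<And>t. t \<in> ball t\<^sub>0 r - {t\<^sub>0} \<Longrightarrow> (j = 0 \<or> y t \<noteq> 0) \<and> (u t, v t) = (coords ! j) (x t, y t)"
    using assms unfolding extends_to_charts_def by blast
  let ?\<Phi> = "\<lambda>t. chart coords j ((u t, v t), t)"
  have "holomorphic_curve_on coords ?\<Phi> (ball t\<^sub>0 r)"
    unfolding holomorphic_curve_on_def
  proof
    fix s
    assume "s \<in> ball t\<^sub>0 r"
    then obtain e where "e > 0" "ball s e \<subseteq> ball t\<^sub>0 r"
      using openE[OF open_ball] by blast
    then show "\<exists>j<length coords. \<exists>e>0. \<exists>u v w. ball s e \<subseteq> ball t\<^sub>0 r \<and> u holomorphic_on ball s e \<and>
        v holomorphic_on ball s e \<and> w holomorphic_on ball s e \<and>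
        (\<forall>t\<in>ball s e. ?\<Phi> t = chart coords j ((u t, v t), w t))"
      using j hol[THEN holomorphic_on_subset]
      by (intro exI[of _ j] conjI exI[of _ e] exI[of _ u] exI[of _ v] exI[of _ "\<lambda>t. t"]) auto
  qed
  moreover have "?\<Phi> t = chart coords 0 ((x t, y t), t)" if "t \<in> ball t\<^sub>0 r - {t\<^sub>0}" for t
  proof -
    have "chart coords 0 ((x t, y t), t) = chart coords j ((u t, v t), t)"
      using eq[OF that] j
      by (auto simp: chart_eq_iff transition_0)
    then show ?thesis ..
  qed
  ultimately show ?thesis
    using \<open>r > 0\<close> by blast
qed

theorem theorem20p2:
  shows "phase_space_by_gluing
    (\<lambda>t (x, y). (x * y, - (y\<^sup>2 / 4) + 3 * x))
    [\<lambda>(x, y). (x, y),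
     \<lambda>(x, y). ((x - y\<^sup>2 / 4) * y, 1 / y),
     \<lambda>(x, y). (x * y ^ 4, 1 / y)]"
proof -
  have all: "(\<forall>T\<in>set coords. P T) \<longleftrightarrow> (\<forall>j<3. P (coords ! j))" for P
    by (simp add: all_set_conv_all_nth)
  have "hd coords = id"
    by (auto simp: coords_def)
  then have "phase_space_by_gluing rhs coords"
    unfolding phase_space_by_gluing_def all
    using birational_coords glues_to_complex_manifold_coords fibred_over_time_coords
      rewritten_system_coords_0 rewritten_system_coords_1 rewritten_system_coords_2
      meromorphic_solution_extends holomorphic_curve_if_extends
    by (auto simp: all_less_3) (simp_all add: coords_def)
  then show ?thesis
    by (simp add: rhs_def coords_def)
qed

end
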